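(* Let $A,B,C$ be unital algebras and $R_1:B\otimes A\to A\otimes B$, $R_2:C\otimes B\to B\otimes C$, $R_3:C\otimes A\to A\otimes C$ be unital twisting maps satisfying the hexagon equation $$(A\otimes R_2)\circ(R_3\otimes B)\circ(C\otimes R_1)=(R_1\otimes C)\circ(B\otimes R_3)\circ(R_2\otimes A).$$ If $M$ is a vector space, then $M$ is a left $A\otimes_{R_1}B\otimes_{R_2}C$-module if and only if it is a left $A$-module, a left $B$-module and a left $C$-module (all actions are denoted by $\cdot$) satisfying the compatibility conditions $$b\cdot(a\cdot m)=a_{R_1}\cdot(b_{R_1}\cdot m),\qquad c\cdot(b\cdot m)=b_{R_2}\cdot(c_{R_2}\cdot m),\qquad c\cdot(a\cdot m)=a_{R_3}\cdot(c_{R_3}\cdot m)$$ for all $a\in A$, $b\in B$, $c\in C$, $m\in M$ (these conditions tell that $M$ is a left module over $A\otimes_{R_1}B$, $B\otimes_{R_2}C$ and $A\otimes_{R_3}C$).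
   Context: Fix a field or commutative ring $k$; $\otimes=\otimes_k$; algebras are associative $k$-algebras and $\mu_A$ is the product of $A$. An object also denotes its identity map. A twisting map for algebras $A,B$ is a $k$-linear map $R:B\otimes A\to A\otimes B$ with $$R\circ(B\otimes\mu_A)=(\mu_A\otimes B)\circ(A\otimes R)\circ(R\otimes A),\qquad R\circ(\mu_B\otimes A)=(A\otimes\mu_B)\circ(R\otimes B)\circ(B\otimes R);$$ it is unital if $R(1\otimes a)=a\otimes1$ and $R(b\otimes1)=1\otimes b$ for all $a\in A$, $b\in B$. $A\otimes_R B$ denotes $A\otimes B$ with the associative product $\mu_R:=(\mu_A\otimes\mu_B)\circ(A\otimes R\otimes B)$. Sweedler-type notation: $R(b\otimes a)=a_R\otimes b_R$ (summation understood), so $R_1(b\otimes a)=a_{R_1}\otimes b_{R_1}$, $R_2(c\otimes b)=b_{R_2}\otimes c_{R_2}$, $R_3(c\otimes a)=a_{R_3}\otimes c_{R_3}$. Under the hexagon equation, $T_1:=(A\otimes R_2)\circ(R_3\otimes B)$ and $T_2:=(R_1\otimes C)\circ(B\otimes R_3)$ are twisting maps, and $A\otimes_{R_1}B\otimes_{R_2}C$ denotes the algebra $(A\otimes_{R_1}B)\otimes_{T_1}C$, which equals $A\otimes_{T_2}(B\otimes_{R_2}C)$. *)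

theory Defs
  imports "HOL-Algebra.Module" "HOL-Algebra.Free_Abelian_Groups"
begin

section \<open>Tensor products of modules over a commutative ring\<close>

text \<open>
  The tensor product of two \<open>K\<close>-modules is the free abelian group on pairs modulo the subgroup
  generated by the biadditivity and \<open>K\<close>-balancedness relations. The free group is written
  multiplicatively in the library, its product being addition of finitely supported functions.
\<close>

definition tensor_free ::
    "('k, 'm) module \<Rightarrow> ('k, 'n) module \<Rightarrow> ('m \<times> 'n \<Rightarrow>\<^sub>0 int) monoid" where
  "tensor_free M N = free_Abelian_group (carrier M \<times> carrier N)"

definition tensor_rel ::
    "'k ring \<Rightarrow> ('k, 'm) module \<Rightarrow> ('k, 'n) module \<Rightarrow> ('m \<times> 'n \<Rightarrow>\<^sub>0 int) set" where
  "tensor_rel K M N = generate (tensor_free M N)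
     ({frag_of (m \<oplus>\<^bsub>M\<^esub> m', n) - frag_of (m, n) - frag_of (m', n) |m m' n.
         m \<in> carrier M \<and> m' \<in> carrier M \<and> n \<in> carrier N} \<union>
      {frag_of (m, n \<oplus>\<^bsub>N\<^esub> n') - frag_of (m, n) - frag_of (m, n') |m n n'.
         m \<in> carrier M \<and> n \<in> carrier N \<and> n' \<in> carrier N} \<union>
      {frag_of (r \<odot>\<^bsub>M\<^esub> m, n) - frag_of (m, r \<odot>\<^bsub>N\<^esub> n) |r m n.
         r \<in> carrier K \<and> m \<in> carrier M \<and> n \<in> carrier N})"

definition pure_tensor ::
    "'k ring \<Rightarrow> ('k, 'm) module \<Rightarrow> ('k, 'n) module \<Rightarrow> 'm \<Rightarrow> 'n \<Rightarrow> ('m \<times> 'n \<Rightarrow>\<^sub>0 int) set" where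
  "pure_tensor K M N m n = tensor_rel K M N #>\<^bsub>tensor_free M N\<^esub> frag_of (m, n)"

text \<open>
  Only a module, so the multiplicative fields of the record carry no meaning. The scalar \<open>r\<close> acts
  on the class of \<open>x\<close> through \<open>(m, n) \<mapsto> (r m, n)\<close>; here and in \<open>tensor_lift\<close> the image under
  \<open>the_elem\<close> is a singleton because the map is constant on cosets of the relations.
\<close>

definition tensor ::
    "'k ring \<Rightarrow> ('k, 'm) module \<Rightarrow> ('k, 'n) module \<Rightarrow> ('k, ('m \<times> 'n \<Rightarrow>\<^sub>0 int) set) module" where
  "tensor K M N =
    \<lparr>carrier = carrier (tensor_free M N Mod tensor_rel K M N),
     mult = undefined,
     one = undefined,
     ring.zero = \<one>\<^bsub>tensor_free M N Mod tensor_rel K M N\<^esub>,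
     add = monoid.mult (tensor_free M N Mod tensor_rel K M N),
     smult = (\<lambda>r X. the_elem
       ((\<lambda>x. tensor_rel K M N #>\<^bsub>tensor_free M N\<^esub>
               frag_extend (\<lambda>(m, n). frag_of (r \<odot>\<^bsub>M\<^esub> m, n)) x) ` X))\<rparr>"

text \<open>
  The map out of a tensor product into \<open>P\<close> induced by a biadditive balanced \<open>f\<close>, sending
  \<open>\<Sum> m\<^sub>i \<otimes> n\<^sub>i\<close> to \<open>\<Sum> f m\<^sub>i n\<^sub>i\<close>.
\<close>

definition tensor_lift ::
    "('k, 'p) module \<Rightarrow> ('m \<Rightarrow> 'n \<Rightarrow> 'p) \<Rightarrow> ('m \<times> 'n \<Rightarrow>\<^sub>0 int) set \<Rightarrow> 'p" where
  "tensor_lift P f X = the_elem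
     ((\<lambda>x. \<Oplus>\<^bsub>P\<^esub>p\<in>Poly_Mapping.keys x. [Poly_Mapping.lookup x p] \<cdot>\<^bsub>P\<^esub> f (fst p) (snd p)) ` X)"

text \<open>\<open>f \<otimes> g\<close> for \<open>f\<close> and \<open>g\<close> with codomains \<open>M\<close> and \<open>N\<close>.\<close>

definition tensor_map ::
    "'k ring \<Rightarrow> ('k, 'm) module \<Rightarrow> ('k, 'n) module \<Rightarrow> ('a \<Rightarrow> 'm) \<Rightarrow> ('b \<Rightarrow> 'n)
      \<Rightarrow> ('a \<times> 'b \<Rightarrow>\<^sub>0 int) set \<Rightarrow> ('m \<times> 'n \<Rightarrow>\<^sub>0 int) set" where
  "tensor_map K M N f g = tensor_lift (tensor K M N) (\<lambda>x y. pure_tensor K M N (f x) (g y))"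

text \<open>
  The canonical isomorphisms between \<open>(X \<otimes> Y) \<otimes> Z\<close> and \<open>X \<otimes> (Y \<otimes> Z)\<close>, which are suppressed in
  the usual notation and are inserted explicitly below.
\<close>

definition tensor_assoc ::
    "'k ring \<Rightarrow> ('k, 'x) module \<Rightarrow> ('k, 'y) module \<Rightarrow> ('k, 'z) module
      \<Rightarrow> (('x \<times> 'y \<Rightarrow>\<^sub>0 int) set \<times> 'z \<Rightarrow>\<^sub>0 int) set
      \<Rightarrow> ('x \<times> ('y \<times> 'z \<Rightarrow>\<^sub>0 int) set \<Rightarrow>\<^sub>0 int) set" where
  "tensor_assoc K X Y Z =
     tensor_lift (tensor K X (tensor K Y Z)) (\<lambda>t z.
       tensor_lift (tensor K X (tensor K Y Z)) (\<lambda>x y.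
         pure_tensor K X (tensor K Y Z) x (pure_tensor K Y Z y z)) t)"

definition tensor_assoc_inv ::
    "'k ring \<Rightarrow> ('k, 'x) module \<Rightarrow> ('k, 'y) module \<Rightarrow> ('k, 'z) module
      \<Rightarrow> ('x \<times> ('y \<times> 'z \<Rightarrow>\<^sub>0 int) set \<Rightarrow>\<^sub>0 int) set
      \<Rightarrow> (('x \<times> 'y \<Rightarrow>\<^sub>0 int) set \<times> 'z \<Rightarrow>\<^sub>0 int) set" where
  "tensor_assoc_inv K X Y Z =
     tensor_lift (tensor K (tensor K X Y) Z) (\<lambda>x t.
       tensor_lift (tensor K (tensor K X Y) Z) (\<lambda>y z.
         pure_tensor K (tensor K X Y) Z (pure_tensor K X Y x y) z) t)"

definition linear_map ::
    "'k ring \<Rightarrow> ('k, 'm) module \<Rightarrow> ('k, 'n) module \<Rightarrow> ('m \<Rightarrow> 'n) \<Rightarrow> bool" where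
  "linear_map K M N f \<longleftrightarrow>
     f \<in> carrier M \<rightarrow> carrier N \<and>
     (\<forall>x\<in>carrier M. \<forall>y\<in>carrier M. f (x \<oplus>\<^bsub>M\<^esub> y) = f x \<oplus>\<^bsub>N\<^esub> f y) \<and>
     (\<forall>r\<in>carrier K. \<forall>x\<in>carrier M. f (r \<odot>\<^bsub>M\<^esub> x) = r \<odot>\<^bsub>N\<^esub> f x)"


section \<open>Algebras and their left modules\<close>

text \<open>
  Unital associative algebras; the library locale \<^locale>\<open>algebra\<close> requires commutativity.
\<close>

locale unital_algebra = module K A + ring A
  for K :: "'k ring" and A :: "('k, 'a) module" +
  assumes smult_mult_left: "\<lbrakk>r \<in> carrier K; x \<in> carrier A; y \<in> carrier A\<rbrakk>
      \<Longrightarrow> (r \<odot>\<^bsub>A\<^esub> x) \<otimes>\<^bsub>A\<^esub> y = r \<odot>\<^bsub>A\<^esub> (x \<otimes>\<^bsub>A\<^esub> y)"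
    and smult_mult_right: "\<lbrakk>r \<in> carrier K; x \<in> carrier A; y \<in> carrier A\<rbrakk>
      \<Longrightarrow> x \<otimes>\<^bsub>A\<^esub> (r \<odot>\<^bsub>A\<^esub> y) = r \<odot>\<^bsub>A\<^esub> (x \<otimes>\<^bsub>A\<^esub> y)"

text \<open>
  \<open>left_module K A M act\<close>: the map \<open>act\<close> is a unital left action of \<open>A\<close> on the \<open>K\<close>-module \<open>M\<close>,
  \<open>K\<close>-bilinear for the given \<open>K\<close>-module structure of \<open>M\<close>.
\<close>

locale left_module = module K M
  for K :: "'k ring" and A :: "('k, 'a) module" and M :: "('k, 'm) module"
    and act :: "'a \<Rightarrow> 'm \<Rightarrow> 'm" +
  assumes act_closed: "\<lbrakk>a \<in> carrier A; m \<in> carrier M\<rbrakk> \<Longrightarrow> act a m \<in> carrier M"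
    and act_add_left: "\<lbrakk>a \<in> carrier A; a' \<in> carrier A; m \<in> carrier M\<rbrakk>
      \<Longrightarrow> act (a \<oplus>\<^bsub>A\<^esub> a') m = act a m \<oplus>\<^bsub>M\<^esub> act a' m"
    and act_add_right: "\<lbrakk>a \<in> carrier A; m \<in> carrier M; m' \<in> carrier M\<rbrakk>
      \<Longrightarrow> act a (m \<oplus>\<^bsub>M\<^esub> m') = act a m \<oplus>\<^bsub>M\<^esub> act a m'"
    and act_smult_left: "\<lbrakk>r \<in> carrier K; a \<in> carrier A; m \<in> carrier M\<rbrakk>
      \<Longrightarrow> act (r \<odot>\<^bsub>A\<^esub> a) m = r \<odot>\<^bsub>M\<^esub> act a m"
    and act_smult_right: "\<lbrakk>r \<in> carrier K; a \<in> carrier A; m \<in> carrier M\<rbrakk>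
      \<Longrightarrow> act a (r \<odot>\<^bsub>M\<^esub> m) = r \<odot>\<^bsub>M\<^esub> act a m"
    and act_mult: "\<lbrakk>a \<in> carrier A; a' \<in> carrier A; m \<in> carrier M\<rbrakk>
      \<Longrightarrow> act (a \<otimes>\<^bsub>A\<^esub> a') m = act a (act a' m)"
    and act_one: "m \<in> carrier M \<Longrightarrow> act \<one>\<^bsub>A\<^esub> m = m"


section \<open>Twisted tensor products\<close>

definition mult_map :: "('k, 'a) module \<Rightarrow> ('a \<times> 'a \<Rightarrow>\<^sub>0 int) set \<Rightarrow> 'a" where
  "mult_map A = tensor_lift A (monoid.mult A)"

text \<open>
  \<open>R : B \<otimes> A \<rightarrow> A \<otimes> B\<close>; the first equation lives on \<open>B \<otimes> (A \<otimes> A)\<close>, the second one on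
  \<open>(B \<otimes> B) \<otimes> A\<close>.
\<close>

definition twisting_map ::
    "'k ring \<Rightarrow> ('k, 'a) module \<Rightarrow> ('k, 'b) module
      \<Rightarrow> (('b \<times> 'a \<Rightarrow>\<^sub>0 int) set \<Rightarrow> ('a \<times> 'b \<Rightarrow>\<^sub>0 int) set) \<Rightarrow> bool" where
  "twisting_map K A B R \<longleftrightarrow>
     linear_map K (tensor K B A) (tensor K A B) R \<and>
     (\<forall>x\<in>carrier (tensor K B (tensor K A A)).
        (R \<circ> tensor_map K B A id (mult_map A)) x =
        (tensor_map K A B (mult_map A) id \<circ> tensor_assoc_inv K A A B
          \<circ> tensor_map K A (tensor K A B) id R \<circ> tensor_assoc K A B A
          \<circ> tensor_map K (tensor K A B) A R id \<circ> tensor_assoc_inv K B A A) x) \<and>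
     (\<forall>x\<in>carrier (tensor K (tensor K B B) A).
        (R \<circ> tensor_map K B A (mult_map B) id) x =
        (tensor_map K A B id (mult_map B) \<circ> tensor_assoc K A B B
          \<circ> tensor_map K (tensor K A B) B R id \<circ> tensor_assoc_inv K B A B
          \<circ> tensor_map K B (tensor K A B) id R \<circ> tensor_assoc K B B A) x)"

definition unital_twisting_map ::
    "'k ring \<Rightarrow> ('k, 'a) module \<Rightarrow> ('k, 'b) module
      \<Rightarrow> (('b \<times> 'a \<Rightarrow>\<^sub>0 int) set \<Rightarrow> ('a \<times> 'b \<Rightarrow>\<^sub>0 int) set) \<Rightarrow> bool" where
  "unital_twisting_map K A B R \<longleftrightarrow>
     twisting_map K A B R \<and>
     (\<forall>a\<in>carrier A. R (pure_tensor K B A \<one>\<^bsub>B\<^esub> a) = pure_tensor K A B a \<one>\<^bsub>B\<^esub>) \<and>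
     (\<forall>b\<in>carrier B. R (pure_tensor K B A b \<one>\<^bsub>A\<^esub>) = pure_tensor K A B \<one>\<^bsub>A\<^esub> b)"

text \<open>
  \<open>(\<mu>\<^sub>A \<otimes> \<mu>\<^sub>B) \<circ> (A \<otimes> R \<otimes> B)\<close> as a map on \<open>(A \<otimes> B) \<otimes> (A \<otimes> B)\<close>, passing through
  \<open>A \<otimes> ((B \<otimes> A) \<otimes> B)\<close> and \<open>A \<otimes> ((A \<otimes> B) \<otimes> B)\<close>.
\<close>

definition twisted_mult_map ::
    "'k ring \<Rightarrow> ('k, 'a) module \<Rightarrow> ('k, 'b) module
      \<Rightarrow> (('b \<times> 'a \<Rightarrow>\<^sub>0 int) set \<Rightarrow> ('a \<times> 'b \<Rightarrow>\<^sub>0 int) set)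
      \<Rightarrow> (('a \<times> 'b \<Rightarrow>\<^sub>0 int) set \<times> ('a \<times> 'b \<Rightarrow>\<^sub>0 int) set \<Rightarrow>\<^sub>0 int) set
      \<Rightarrow> ('a \<times> 'b \<Rightarrow>\<^sub>0 int) set" where
  "twisted_mult_map K A B R =
     tensor_map K A B (mult_map A) (mult_map B)
     \<circ> tensor_assoc_inv K A A (tensor K B B)
     \<circ> tensor_map K A (tensor K A (tensor K B B)) id (tensor_assoc K A B B)
     \<circ> tensor_map K A (tensor K (tensor K A B) B) id (tensor_map K (tensor K A B) B R id)
     \<circ> tensor_map K A (tensor K (tensor K B A) B) id (tensor_assoc_inv K B A B)
     \<circ> tensor_assoc K A B (tensor K A B)"

definition twisted_product ::
    "'k ring \<Rightarrow> ('k, 'a) module \<Rightarrow> ('k, 'b) module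
      \<Rightarrow> (('b \<times> 'a \<Rightarrow>\<^sub>0 int) set \<Rightarrow> ('a \<times> 'b \<Rightarrow>\<^sub>0 int) set)
      \<Rightarrow> ('k, ('a \<times> 'b \<Rightarrow>\<^sub>0 int) set) module" where
  "twisted_product K A B R = (tensor K A B)
     \<lparr>mult := (\<lambda>x y. twisted_mult_map K A B R (pure_tensor K (tensor K A B) (tensor K A B) x y)),
      one := pure_tensor K A B \<one>\<^bsub>A\<^esub> \<one>\<^bsub>B\<^esub>\<rparr>"

text \<open>The hexagon equation, as maps from \<open>(C \<otimes> B) \<otimes> A\<close> to \<open>A \<otimes> (B \<otimes> C)\<close>.\<close>

definition hexagon ::
    "'k ring \<Rightarrow> ('k, 'a) module \<Rightarrow> ('k, 'b) module \<Rightarrow> ('k, 'c) module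
      \<Rightarrow> (('b \<times> 'a \<Rightarrow>\<^sub>0 int) set \<Rightarrow> ('a \<times> 'b \<Rightarrow>\<^sub>0 int) set)
      \<Rightarrow> (('c \<times> 'b \<Rightarrow>\<^sub>0 int) set \<Rightarrow> ('b \<times> 'c \<Rightarrow>\<^sub>0 int) set)
      \<Rightarrow> (('c \<times> 'a \<Rightarrow>\<^sub>0 int) set \<Rightarrow> ('a \<times> 'c \<Rightarrow>\<^sub>0 int) set) \<Rightarrow> bool" where
  "hexagon K A B C R1 R2 R3 \<longleftrightarrow>
     (\<forall>x\<in>carrier (tensor K (tensor K C B) A).
        (tensor_map K A (tensor K B C) id R2 \<circ> tensor_assoc K A C B
          \<circ> tensor_map K (tensor K A C) B R3 id \<circ> tensor_assoc_inv K C A B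
          \<circ> tensor_map K C (tensor K A B) id R1 \<circ> tensor_assoc K C B A) x =
        (tensor_assoc K A B C \<circ> tensor_map K (tensor K A B) C R1 id
          \<circ> tensor_assoc_inv K B A C \<circ> tensor_map K B (tensor K A C) id R3
          \<circ> tensor_assoc K B C A \<circ> tensor_map K (tensor K B C) A R2 id) x)"

text \<open>\<open>T\<^sub>1 = (A \<otimes> R\<^sub>2) \<circ> (R\<^sub>3 \<otimes> B)\<close>, from \<open>C \<otimes> (A \<otimes> B)\<close> to \<open>(A \<otimes> B) \<otimes> C\<close>.\<close>

definition iterated_twist ::
    "'k ring \<Rightarrow> ('k, 'a) module \<Rightarrow> ('k, 'b) module \<Rightarrow> ('k, 'c) module
      \<Rightarrow> (('c \<times> 'b \<Rightarrow>\<^sub>0 int) set \<Rightarrow> ('b \<times> 'c \<Rightarrow>\<^sub>0 int) set)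
      \<Rightarrow> (('c \<times> 'a \<Rightarrow>\<^sub>0 int) set \<Rightarrow> ('a \<times> 'c \<Rightarrow>\<^sub>0 int) set)
      \<Rightarrow> ('c \<times> ('a \<times> 'b \<Rightarrow>\<^sub>0 int) set \<Rightarrow>\<^sub>0 int) set
      \<Rightarrow> (('a \<times> 'b \<Rightarrow>\<^sub>0 int) set \<times> 'c \<Rightarrow>\<^sub>0 int) set" where
  "iterated_twist K A B C R2 R3 =
     tensor_assoc_inv K A B C \<circ> tensor_map K A (tensor K B C) id R2 \<circ> tensor_assoc K A C B
     \<circ> tensor_map K (tensor K A C) B R3 id \<circ> tensor_assoc_inv K C A B"

definition iterated_product ::
    "'k ring \<Rightarrow> ('k, 'a) module \<Rightarrow> ('k, 'b) module \<Rightarrow> ('k, 'c) module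
      \<Rightarrow> (('b \<times> 'a \<Rightarrow>\<^sub>0 int) set \<Rightarrow> ('a \<times> 'b \<Rightarrow>\<^sub>0 int) set)
      \<Rightarrow> (('c \<times> 'b \<Rightarrow>\<^sub>0 int) set \<Rightarrow> ('b \<times> 'c \<Rightarrow>\<^sub>0 int) set)
      \<Rightarrow> (('c \<times> 'a \<Rightarrow>\<^sub>0 int) set \<Rightarrow> ('a \<times> 'c \<Rightarrow>\<^sub>0 int) set)
      \<Rightarrow> ('k, (('a \<times> 'b \<Rightarrow>\<^sub>0 int) set \<times> 'c \<Rightarrow>\<^sub>0 int) set) module" where
  "iterated_product K A B C R1 R2 R3 =
     twisted_product K (twisted_product K A B R1) C (iterated_twist K A B C R2 R3)"

definition pure_tensor3 ::
    "'k ring \<Rightarrow> ('k, 'a) module \<Rightarrow> ('k, 'b) module \<Rightarrow> ('k, 'c) module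
      \<Rightarrow> 'a \<Rightarrow> 'b \<Rightarrow> 'c \<Rightarrow> (('a \<times> 'b \<Rightarrow>\<^sub>0 int) set \<times> 'c \<Rightarrow>\<^sub>0 int) set" where
  "pure_tensor3 K A B C a b c = pure_tensor K (tensor K A B) C (pure_tensor K A B a b) c"

text \<open>
  \<open>b \<cdot> (a \<cdot> m) = a\<^sub>R \<cdot> (b\<^sub>R \<cdot> m)\<close>: the right-hand side is the value at \<open>R (b \<otimes> a)\<close> of the map on
  \<open>A \<otimes> B\<close> induced by \<open>(a', b') \<mapsto> a' \<cdot> (b' \<cdot> m)\<close>.
\<close>

definition twist_compatible ::
    "'k ring \<Rightarrow> ('k, 'a) module \<Rightarrow> ('k, 'b) module
      \<Rightarrow> (('b \<times> 'a \<Rightarrow>\<^sub>0 int) set \<Rightarrow> ('a \<times> 'b \<Rightarrow>\<^sub>0 int) set)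
      \<Rightarrow> ('k, 'm) module \<Rightarrow> ('a \<Rightarrow> 'm \<Rightarrow> 'm) \<Rightarrow> ('b \<Rightarrow> 'm \<Rightarrow> 'm) \<Rightarrow> bool" where
  "twist_compatible K A B R M actA actB \<longleftrightarrow>
     (\<forall>a\<in>carrier A. \<forall>b\<in>carrier B. \<forall>m\<in>carrier M.
        actB b (actA a m) =
        tensor_lift M (\<lambda>a' b'. actA a' (actB b' m)) (R (pure_tensor K B A b a)))"

end

theory Submission
  imports Defs
begin

text \<open>
  Let \<open>R : B \<otimes> A \<rightarrow> A \<otimes> B\<close> be linear and unital. In \<open>A \<otimes>\<^sub>R B\<close> one has
  \<open>(a \<otimes> 1) (1 \<otimes> b) = a \<otimes> b\<close> and \<open>(1 \<otimes> b) (a \<otimes> 1) = R (b \<otimes> a)\<close>. So an action of \<open>A \<otimes>\<^sub>R B\<close> restricts to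
  actions of \<open>A\<close> and \<open>B\<close> which determine it by \<open>(a \<otimes> b) \<cdot> m = a \<cdot> (b \<cdot> m)\<close> and are compatible with \<open>R\<close>;
  conversely this formula defines an action as soon as the compatibility holds, because
  \<open>(a \<otimes> b) (a' \<otimes> b')\<close> is the image of \<open>R (b \<otimes> a')\<close> under \<open>u \<otimes> v \<mapsto> a u \<otimes> v b'\<close>. The theorem follows by
  applying this to \<open>A\<close>, \<open>B\<close>, \<open>R\<^sub>1\<close> and then to \<open>A \<otimes>\<^sub>R B\<close>, \<open>C\<close>, \<open>T\<^sub>1\<close>: evaluating on \<open>c \<otimes> (a \<otimes> b)\<close>, and at
  \<open>a = 1\<close> or \<open>b = 1\<close> for the converse, compatibility with \<open>T\<^sub>1\<close> amounts to compatibility with both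
  \<open>R\<^sub>2\<close> and \<open>R\<^sub>3\<close>.
\<close>

section \<open>Tensor products\<close>

text \<open>A homomorphism that kills \<open>N\<close> is constant on cosets of \<open>N\<close>,
  and \<open>x\<close> lies in its own coset, so the image is exactly the singleton of
  \<open>h x\<close>. This evaluates the \<open>the_elem\<close> in the scalar action of
  \<open>tensor\<close> and in \<open>tensor_lift\<close>.\<close>

lemma (in group_hom) the_elem_image_r_coset:
  assumes "subgroup N G" and "\<And>n. n \<in> N \<Longrightarrow> h n = \<one>\<^bsub>H\<^esub>" and x: "x \<in> carrier G"
  shows "the_elem (h ` (N #> x)) = h x"
proof -
  interpret N: subgroup N G by fact
  have "h ` (N #> x) = {h x}"
  proof
    show "h ` (N #> x) \<subseteq> {h x}"
      using assms by (auto simp: r_coset_def)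
    show "{h x} \<subseteq> h ` (N #> x)"
      using G.rcos_self[OF x assms(1)] by auto
  qed
  then show ?thesis by simp
qed

text \<open>The kernel is a subgroup containing \<open>S\<close>, hence it contains
  \<open>generate G S\<close>.\<close>

lemma (in group_hom) trivial_on_generate:
  assumes "S \<subseteq> carrier G" and "\<And>s. s \<in> S \<Longrightarrow> h s = \<one>\<^bsub>H\<^esub>" and "x \<in> generate G S"
  shows "h x = \<one>\<^bsub>H\<^esub>"
proof -
  have "generate G S \<subseteq> kernel G H h"
    by (rule G.generate_subgroup_incl[OF _ subgroup_kernel]) (use assms in \<open>auto simp: kernel_def\<close>)
  with assms show ?thesis by (auto simp: kernel_def)
qed

text \<open>Existence half of the universal property of the free abelian group, in multiplicative
  notation. Since \<open>x\<close>, \<open>y\<close> and \<open>x + y\<close> have different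
  supports, all three products are first rewritten over the union \<open>?U\<close>, where
  additivity is termwise.\<close>

lemma (in comm_group) free_Abelian_group_lift_hom:
  assumes f: "f \<in> S \<rightarrow> carrier G"
  shows "(\<lambda>x. finprod G (\<lambda>p. f p [^] Poly_Mapping.lookup x p) (Poly_Mapping.keys x))
    \<in> hom (free_Abelian_group S) G" (is "?h \<in> _")
proof (rule homI)
  fix x
  assume x: "x \<in> carrier (free_Abelian_group S)"
  then show "?h x \<in> carrier G"
    using f by (intro finprod_closed) auto
  fix y
  assume y: "y \<in> carrier (free_Abelian_group S)"
  let ?U = "Poly_Mapping.keys x \<union> Poly_Mapping.keys y"
  have U: "?U \<subseteq> S" using x y by auto
  have closed: "(\<lambda>p. f p [^] (k p :: int)) \<in> ?U \<rightarrow> carrier G" for k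
    using f U by auto
  \<comment> \<open>Enlarging the index set only adds factors with exponent 0, which are
    trivial.\<close>
  have ext: "?h z = finprod G (\<lambda>p. f p [^] Poly_Mapping.lookup z p) ?U"
    if "Poly_Mapping.keys z \<subseteq> ?U" for z
    by (rule finprod_mono_neutral_cong_left)
       (use that closed in \<open>auto simp: in_keys_iff\<close>)
  have "?h (x + y) = finprod G (\<lambda>p. f p [^] Poly_Mapping.lookup (x + y) p) ?U"
    by (rule ext) (rule keys_add)
  also have "\<dots> = finprod G (\<lambda>p. f p [^] Poly_Mapping.lookup x p \<otimes> f p [^] Poly_Mapping.lookup y p) ?U"
    by (rule finprod_cong) (use f U in \<open>auto simp: lookup_add int_pow_mult simp_implies_def Pi_iff subset_iff\<close>)
  also have "\<dots> = finprod G (\<lambda>p. f p [^] Poly_Mapping.lookup x p) ?U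
      \<otimes> finprod G (\<lambda>p. f p [^] Poly_Mapping.lookup y p) ?U"
    by (rule finprod_multf) (rule closed)+
  also have "\<dots> = ?h x \<otimes> ?h y"
    by (simp add: ext)
  finally show "?h (x \<otimes>\<^bsub>free_Abelian_group S\<^esub> y) = ?h x \<otimes> ?h y" by simp
qed

section \<open>The relation subgroup and its cosets\<close>

abbreviation tensor_class ::
    "'k ring \<Rightarrow> ('k, 'm) module \<Rightarrow> ('k, 'n) module \<Rightarrow> ('m \<times> 'n \<Rightarrow>\<^sub>0 int) \<Rightarrow> ('m \<times> 'n \<Rightarrow>\<^sub>0 int) set" where
  "tensor_class K M N x \<equiv> tensor_rel K M N #>\<^bsub>tensor_free M N\<^esub> x"

text \<open>Naming the generators separates two uses: a single relation lies in the subgroup, and a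
  homomorphism vanishing on all of them vanishes on the subgroup.\<close>

definition tensor_gens ::
    "'k ring \<Rightarrow> ('k, 'm) module \<Rightarrow> ('k, 'n) module \<Rightarrow> ('m \<times> 'n \<Rightarrow>\<^sub>0 int) set" where
  "tensor_gens K M N =
     {frag_of (m \<oplus>\<^bsub>M\<^esub> m', n) - frag_of (m, n) - frag_of (m', n) |m m' n.
         m \<in> carrier M \<and> m' \<in> carrier M \<and> n \<in> carrier N} \<union>
      {frag_of (m, n \<oplus>\<^bsub>N\<^esub> n') - frag_of (m, n) - frag_of (m, n') |m n n'.
         m \<in> carrier M \<and> n \<in> carrier N \<and> n' \<in> carrier N} \<union>
      {frag_of (r \<odot>\<^bsub>M\<^esub> m, n) - frag_of (m, r \<odot>\<^bsub>N\<^esub> n) |r m n.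
         r \<in> carrier K \<and> m \<in> carrier M \<and> n \<in> carrier N}"

lemma tensor_rel_eq: "tensor_rel K M N = generate (tensor_free M N) (tensor_gens K M N)"
  by (simp add: tensor_rel_def tensor_gens_def)

lemma comm_group_tensor_free: "comm_group (tensor_free M N)"
  by (simp add: tensor_free_def abelian_free_Abelian_group)

lemma mult_tensor_free [simp]: "x \<otimes>\<^bsub>tensor_free M N\<^esub> y = x + y"
  by (simp add: tensor_free_def)

lemma one_tensor_free [simp]: "\<one>\<^bsub>tensor_free M N\<^esub> = 0"
  by (simp add: tensor_free_def)

lemma in_tensor_free_iff: "x \<in> carrier (tensor_free M N) \<longleftrightarrow> Poly_Mapping.keys x \<subseteq> carrier M \<times> carrier N"
  by (simp add: tensor_free_def)

lemma diff_in_tensor_free: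
  "\<lbrakk>x \<in> carrier (tensor_free M N); y \<in> carrier (tensor_free M N)\<rbrakk> \<Longrightarrow> x - y \<in> carrier (tensor_free M N)"
  unfolding in_tensor_free_iff using keys_diff[of x y] by blast

lemma add_in_tensor_free:
  "\<lbrakk>x \<in> carrier (tensor_free M N); y \<in> carrier (tensor_free M N)\<rbrakk> \<Longrightarrow> x + y \<in> carrier (tensor_free M N)"
  unfolding in_tensor_free_iff using keys_add[of x y] by blast

lemma zero_in_tensor_free [simp]: "0 \<in> carrier (tensor_free M N)"
  by (simp add: in_tensor_free_iff)

lemma frag_of_in_tensor_free [simp]:
  "frag_of (m, n) \<in> carrier (tensor_free M N) \<longleftrightarrow> m \<in> carrier M \<and> n \<in> carrier N"
  by (simp add: in_tensor_free_iff)

text \<open>Closure under differences instead of sums takes care of negative coefficients.\<close>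

lemma tensor_free_induct [consumes 1, case_names zero frag_of diff]:
  assumes "x \<in> carrier (tensor_free M N)" and "P 0"
    and "\<And>m n. \<lbrakk>m \<in> carrier M; n \<in> carrier N\<rbrakk> \<Longrightarrow> P (frag_of (m, n))"
    and "\<And>x y. \<lbrakk>x \<in> carrier (tensor_free M N); y \<in> carrier (tensor_free M N); P x; P y\<rbrakk> \<Longrightarrow> P (x - y)"
  shows "P x"
  by (rule free_Abelian_group_induct[of x "carrier M \<times> carrier N"])
     (use assms in \<open>auto simp: in_tensor_free_iff\<close>)

section \<open>The tensor product as an abelian group spanned by pure tensors\<close>

context
  fixes K :: "'k ring" and M :: "('k, 'm) module" and N :: "('k, 'n) module"
  assumes M: "module K M" and N: "module K N"
begin

interpretation M: module K M by (rule M)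
interpretation N: module K N by (rule N)
interpretation F: comm_group "tensor_free M N" by (rule comm_group_tensor_free)

lemma tensor_gens_subset: "tensor_gens K M N \<subseteq> carrier (tensor_free M N)"
  by (auto simp: tensor_gens_def intro!: diff_in_tensor_free)

lemma subgroup_tensor_rel: "subgroup (tensor_rel K M N) (tensor_free M N)"
  unfolding tensor_rel_eq by (rule F.generate_is_subgroup) (rule tensor_gens_subset)

lemma normal_tensor_rel: "tensor_rel K M N \<lhd> tensor_free M N"
  by (rule F.subgroup_imp_normal) (rule subgroup_tensor_rel)

interpretation R: normal "tensor_rel K M N" "tensor_free M N" by (rule normal_tensor_rel)

lemma tensor_gens_in_rel: "g \<in> tensor_gens K M N \<Longrightarrow> g \<in> tensor_rel K M N"
  unfolding tensor_rel_eq by (rule generate.incl)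

text \<open>Writing \<open>x = (x - y) + y\<close> puts \<open>x\<close> into the coset of
  \<open>y\<close>, and cosets with a common element coincide.\<close>

lemma tensor_class_eqI:
  assumes "x \<in> carrier (tensor_free M N)" "y \<in> carrier (tensor_free M N)" "x - y \<in> tensor_rel K M N"
  shows "tensor_class K M N x = tensor_class K M N y"
proof -
  have "x \<in> tensor_class K M N y"
    using assms by (auto simp: r_coset_def intro!: bexI[of _ "x - y"])
  then show ?thesis
    using F.repr_independence[OF _ _ subgroup_tensor_rel] assms by metis
qed

lemma carrier_tensor: "carrier (tensor K M N) = tensor_class K M N ` carrier (tensor_free M N)"
  by (simp add: tensor_def carrier_FactGroup)

lemma tensor_class_closed: "x \<in> carrier (tensor_free M N) \<Longrightarrow> tensor_class K M N x \<in> carrier (tensor K M N)"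
  by (simp add: carrier_tensor)

lemma tensor_class_add:
  "\<lbrakk>x \<in> carrier (tensor_free M N); y \<in> carrier (tensor_free M N)\<rbrakk> \<Longrightarrow>
    tensor_class K M N x \<oplus>\<^bsub>tensor K M N\<^esub> tensor_class K M N y = tensor_class K M N (x + y)"
  by (simp add: tensor_def FactGroup_def R.rcos_sum)

lemma tensor_class_zero: "tensor_class K M N 0 = \<zero>\<^bsub>tensor K M N\<^esub>"
  using F.coset_mult_one[OF R.subset] by (simp add: tensor_def FactGroup_def)

lemma abelian_group_tensor: "abelian_group (tensor K M N)"
proof -
  interpret Q: comm_group "tensor_free M N Mod tensor_rel K M N"
    by (rule F.abelian_FactGroup) (rule subgroup_tensor_rel)
  show ?thesis
  proof (rule abelian_groupI)
    fix x assume "x \<in> carrier (tensor K M N)"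
    then show "\<exists>y\<in>carrier (tensor K M N). y \<oplus>\<^bsub>tensor K M N\<^esub> x = \<zero>\<^bsub>tensor K M N\<^esub>"
      unfolding tensor_def using Q.l_inv_ex by simp
  qed (simp_all add: tensor_def Q.m_ac del: mult_FactGroup one_FactGroup)
qed

interpretation T: abelian_group "tensor K M N" by (rule abelian_group_tensor)

lemma tensor_class_diff:
  assumes "x \<in> carrier (tensor_free M N)" "y \<in> carrier (tensor_free M N)"
  shows "tensor_class K M N (x - y) = tensor_class K M N x \<ominus>\<^bsub>tensor K M N\<^esub> tensor_class K M N y"
proof -
  have "tensor_class K M N (x - y) \<oplus>\<^bsub>tensor K M N\<^esub> tensor_class K M N y = tensor_class K M N x"
    using assms by (simp add: tensor_class_add diff_in_tensor_free)
  then show ?thesis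
    using assms by (metis a_minus_def T.a_assoc T.r_neg T.r_zero T.a_inv_closed tensor_class_closed diff_in_tensor_free)
qed

lemma pure_tensor_eq: "pure_tensor K M N m n = tensor_class K M N (frag_of (m, n))"
  by (simp add: pure_tensor_def)

lemma pure_tensor_closed [intro, simp]:
  "\<lbrakk>m \<in> carrier M; n \<in> carrier N\<rbrakk> \<Longrightarrow> pure_tensor K M N m n \<in> carrier (tensor K M N)"
  by (simp add: pure_tensor_eq tensor_class_closed)

lemma pure_tensor_add_left:
  assumes "m \<in> carrier M" "m' \<in> carrier M" "n \<in> carrier N"
  shows "pure_tensor K M N (m \<oplus>\<^bsub>M\<^esub> m') n = pure_tensor K M N m n \<oplus>\<^bsub>tensor K M N\<^esub> pure_tensor K M N m' n"
proof -
  have "frag_of (m \<oplus>\<^bsub>M\<^esub> m', n) - frag_of (m, n) - frag_of (m', n) \<in> tensor_gens K M N"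
    unfolding tensor_gens_def using assms by blast
  then have "tensor_class K M N (frag_of (m \<oplus>\<^bsub>M\<^esub> m', n)) = tensor_class K M N (frag_of (m, n) + frag_of (m', n))"
    using assms by (intro tensor_class_eqI add_in_tensor_free) (auto intro: tensor_gens_in_rel simp: diff_diff_eq)
  with assms show ?thesis by (simp add: pure_tensor_eq tensor_class_add)
qed

lemma pure_tensor_add_right:
  assumes "m \<in> carrier M" "n \<in> carrier N" "n' \<in> carrier N"
  shows "pure_tensor K M N m (n \<oplus>\<^bsub>N\<^esub> n') = pure_tensor K M N m n \<oplus>\<^bsub>tensor K M N\<^esub> pure_tensor K M N m n'"
proof -
  have "frag_of (m, n \<oplus>\<^bsub>N\<^esub> n') - frag_of (m, n) - frag_of (m, n') \<in> tensor_gens K M N"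
    unfolding tensor_gens_def using assms by blast
  then have "tensor_class K M N (frag_of (m, n \<oplus>\<^bsub>N\<^esub> n')) = tensor_class K M N (frag_of (m, n) + frag_of (m, n'))"
    using assms by (intro tensor_class_eqI add_in_tensor_free) (auto intro: tensor_gens_in_rel simp: diff_diff_eq)
  with assms show ?thesis by (simp add: pure_tensor_eq tensor_class_add)
qed

lemma pure_tensor_smult:
  assumes "r \<in> carrier K" "m \<in> carrier M" "n \<in> carrier N"
  shows "pure_tensor K M N (r \<odot>\<^bsub>M\<^esub> m) n = pure_tensor K M N m (r \<odot>\<^bsub>N\<^esub> n)"
proof -
  have "frag_of (r \<odot>\<^bsub>M\<^esub> m, n) - frag_of (m, r \<odot>\<^bsub>N\<^esub> n) \<in> tensor_gens K M N"
    unfolding tensor_gens_def using assms by blast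
  with assms show ?thesis
    unfolding pure_tensor_eq by (intro tensor_class_eqI) (auto intro: tensor_gens_in_rel)
qed

text \<open>Zero and negatives are absorbed by the pure case: \<open>0 = 0 \<otimes> n\<close> and
  \<open>-(m \<otimes> n) = (-m) \<otimes> n\<close>, so sums of pure tensors already exhaust the
  tensor product.\<close>

lemma tensor_induct [consumes 1, case_names pure add]:
  assumes t: "t \<in> carrier (tensor K M N)"
    and pure: "\<And>m n. \<lbrakk>m \<in> carrier M; n \<in> carrier N\<rbrakk> \<Longrightarrow> P (pure_tensor K M N m n)"
    and add: "\<And>s t. \<lbrakk>s \<in> carrier (tensor K M N); t \<in> carrier (tensor K M N); P s; P t\<rbrakk>
      \<Longrightarrow> P (s \<oplus>\<^bsub>tensor K M N\<^esub> t)"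
  shows "P t"
proof -
  let ?T = "tensor K M N" and ?p = "pure_tensor K M N"
  have neg_pure: "\<ominus>\<^bsub>?T\<^esub> ?p m n = ?p (\<ominus>\<^bsub>M\<^esub> m) n"
    and zero_pure: "?p \<zero>\<^bsub>M\<^esub> n = \<zero>\<^bsub>?T\<^esub>" if "m \<in> carrier M" "n \<in> carrier N" for m n
  proof -
    \<comment> \<open>For \<open>u = 0 \<otimes> n\<close>, additivity gives
      \<open>u + u = u\<close>, which forces \<open>u = 0\<close>.\<close>
    have "?p \<zero>\<^bsub>M\<^esub> n \<oplus>\<^bsub>?T\<^esub> ?p \<zero>\<^bsub>M\<^esub> n = ?p \<zero>\<^bsub>M\<^esub> n"
      using that pure_tensor_add_left[of "\<zero>\<^bsub>M\<^esub>" "\<zero>\<^bsub>M\<^esub>" n] by simp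
    then show z: "?p \<zero>\<^bsub>M\<^esub> n = \<zero>\<^bsub>?T\<^esub>"
      using that by (metis T.add.r_cancel_one' pure_tensor_closed M.M.zero_closed)
    have "?p (\<ominus>\<^bsub>M\<^esub> m) n \<oplus>\<^bsub>?T\<^esub> ?p m n = \<zero>\<^bsub>?T\<^esub>"
      using that z pure_tensor_add_left[of "\<ominus>\<^bsub>M\<^esub> m" m n] by (simp add: M.M.l_neg)
    then show "\<ominus>\<^bsub>?T\<^esub> ?p m n = ?p (\<ominus>\<^bsub>M\<^esub> m) n"
      using that by (intro T.minus_equality) auto
  qed
  \<comment> \<open>Representatives are built by differences while \<open>add\<close> handles only
    sums, so the claim is carried for the negative of the class as well.\<close>
  have "P (tensor_class K M N x) \<and> P (\<ominus>\<^bsub>?T\<^esub> tensor_class K M N x)"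
    if "x \<in> carrier (tensor_free M N)" for x
    using that
  proof (induction x rule: tensor_free_induct)
    case zero
    have "P \<zero>\<^bsub>?T\<^esub>"
      using pure[of "\<zero>\<^bsub>M\<^esub>" "\<zero>\<^bsub>N\<^esub>"] zero_pure[of "\<zero>\<^bsub>M\<^esub>" "\<zero>\<^bsub>N\<^esub>"] by simp
    moreover have "\<ominus>\<^bsub>?T\<^esub> \<zero>\<^bsub>?T\<^esub> = \<zero>\<^bsub>?T\<^esub>"
      by (rule T.minus_equality) simp_all
    ultimately show ?case unfolding tensor_class_zero by metis
  next
    case (frag_of m n)
    then show ?case
      using pure neg_pure by (simp flip: pure_tensor_eq)
  next
    case (diff x y)
    note c = diff(1,2)[THEN tensor_class_closed]
    have "P (tensor_class K M N x \<ominus>\<^bsub>?T\<^esub> tensor_class K M N y)"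
      unfolding a_minus_def using diff c by (intro add) auto
    moreover have "P (\<ominus>\<^bsub>?T\<^esub> tensor_class K M N x \<oplus>\<^bsub>?T\<^esub> tensor_class K M N y)"
      using diff c by (intro add) auto
    ultimately show ?case
      using diff(1,2) c by (simp add: tensor_class_diff a_minus_def T.minus_add T.minus_minus)
  qed
  with t show ?thesis by (auto simp: carrier_tensor)
qed

end

text \<open>The three equations correspond to the three families in \<open>tensor_gens\<close>, so
  that the extension to the free group descends to the quotient.\<close>

definition balanced_map ::
    "'k ring \<Rightarrow> ('k, 'm) module \<Rightarrow> ('k, 'n) module \<Rightarrow> ('k, 'p) module \<Rightarrow> ('m \<Rightarrow> 'n \<Rightarrow> 'p) \<Rightarrow> bool" where
  "balanced_map K M N P f \<longleftrightarrow>
     (\<forall>m\<in>carrier M. \<forall>n\<in>carrier N. f m n \<in> carrier P) \<and>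
     (\<forall>m\<in>carrier M. \<forall>m'\<in>carrier M. \<forall>n\<in>carrier N. f (m \<oplus>\<^bsub>M\<^esub> m') n = f m n \<oplus>\<^bsub>P\<^esub> f m' n) \<and>
     (\<forall>m\<in>carrier M. \<forall>n\<in>carrier N. \<forall>n'\<in>carrier N. f m (n \<oplus>\<^bsub>N\<^esub> n') = f m n \<oplus>\<^bsub>P\<^esub> f m n') \<and>
     (\<forall>r\<in>carrier K. \<forall>m\<in>carrier M. \<forall>n\<in>carrier N. f (r \<odot>\<^bsub>M\<^esub> m) n = f m (r \<odot>\<^bsub>N\<^esub> n))"

section \<open>Scalars on the tensor product and its universal property\<close>

context
  fixes K :: "'k ring" and M :: "('k, 'm) module" and N :: "('k, 'n) module"
  assumes M: "module K M" and N: "module K N"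
begin

interpretation M: module K M by (rule M)
interpretation N: module K N by (rule N)
interpretation F: comm_group "tensor_free M N" by (rule comm_group_tensor_free)
interpretation T: abelian_group "tensor K M N" by (rule abelian_group_tensor[OF M N])

text \<open>
  Stated for balanced maps into an abelian group rather than for bilinear maps into a module, so that
  it yields the scalar action of the tensor product before the latter is known to be a module.
\<close>

lemma the_elem_image_tensor_class:
  assumes P: "abelian_group P" and h: "h \<in> hom (tensor_free M N) (add_monoid P)"
    and f: "balanced_map K M N P f"
    and hf: "\<And>m n. \<lbrakk>m \<in> carrier M; n \<in> carrier N\<rbrakk> \<Longrightarrow> h (frag_of (m, n)) = f m n"
    and x: "x \<in> carrier (tensor_free M N)"
  shows "the_elem (h ` tensor_class K M N x) = h x"
proof -
  interpret P: abelian_group P by (rule P)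
  interpret h: group_hom "tensor_free M N" "add_monoid P" h
    by (intro group_hom.intro group_hom_axioms.intro h F.is_group P.a_group)
  have add: "h (x + y) = h x \<oplus>\<^bsub>P\<^esub> h y"
    if "x \<in> carrier (tensor_free M N)" "y \<in> carrier (tensor_free M N)" for x y
    using h.hom_mult[OF that] by simp
  have closed: "h x \<in> carrier P" if "x \<in> carrier (tensor_free M N)" for x
    using h.hom_closed[OF that] by simp
  have diff: "h (x - y) = \<zero>\<^bsub>P\<^esub>"
    if "x \<in> carrier (tensor_free M N)" "y \<in> carrier (tensor_free M N)" "h x = h y" for x y
    using add[of "x - y" y] that diff_in_tensor_free[of x M N y] closed
    by (simp add: P.add.r_cancel_one)
  \<comment> \<open>After grouping terms each relation has the form \<open>u - v\<close> with
    \<open>h u = h v\<close> by balancedness.\<close>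
  have gens: "h g = \<zero>\<^bsub>P\<^esub>" if "g \<in> tensor_gens K M N" for g
    using that f unfolding tensor_gens_def balanced_map_def
    by (auto simp: diff_diff_eq add hf intro!: diff add_in_tensor_free)
  have rel: "h y = \<one>\<^bsub>add_monoid P\<^esub>" if "y \<in> tensor_rel K M N" for y
    using h.trivial_on_generate[OF tensor_gens_subset[OF M N]] gens that
    unfolding tensor_rel_eq by simp
  show ?thesis
    by (rule h.the_elem_image_r_coset[OF subgroup_tensor_rel[OF M N] rel x])
qed

text \<open>Multiplication by \<open>r\<close> is the map induced by
  \<open>(m, n) \<mapsto> (r m) \<otimes> n\<close>. Once this is known to be balanced, the action
  can be computed on any representative, and additivity is inherited from the free group.\<close>

lemma
  assumes r: "r \<in> carrier K"
  shows smult_tensor_pure: "\<lbrakk>m \<in> carrier M; n \<in> carrier N\<rbrakk> \<Longrightarrow>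
      r \<odot>\<^bsub>tensor K M N\<^esub> pure_tensor K M N m n = pure_tensor K M N (r \<odot>\<^bsub>M\<^esub> m) n" (is "PROP ?pure")
    and smult_tensor_closed: "t \<in> carrier (tensor K M N) \<Longrightarrow>
      r \<odot>\<^bsub>tensor K M N\<^esub> t \<in> carrier (tensor K M N)" (is "PROP ?closed")
    and smult_tensor_add: "\<lbrakk>s \<in> carrier (tensor K M N); t \<in> carrier (tensor K M N)\<rbrakk> \<Longrightarrow>
      r \<odot>\<^bsub>tensor K M N\<^esub> (s \<oplus>\<^bsub>tensor K M N\<^esub> t) =
      r \<odot>\<^bsub>tensor K M N\<^esub> s \<oplus>\<^bsub>tensor K M N\<^esub> r \<odot>\<^bsub>tensor K M N\<^esub> t" (is "PROP ?add")
proof -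
  let ?T = "tensor K M N"
  let ?e = "frag_extend (\<lambda>(m, n). frag_of (r \<odot>\<^bsub>M\<^esub> m, n))"
  let ?h = "\<lambda>x. tensor_class K M N (?e x)"
  have e: "?e x \<in> carrier (tensor_free M N)" if "x \<in> carrier (tensor_free M N)" for x
    using that
    by (induction x rule: tensor_free_induct)
       (use r in \<open>auto simp: frag_extend_diff intro: diff_in_tensor_free\<close>)
  have h: "?h \<in> hom (tensor_free M N) (add_monoid ?T)"
    using e by (intro homI)
      (simp_all add: frag_extend_add tensor_class_add[OF M N] tensor_class_closed[OF M N])
  have f: "balanced_map K M N ?T (\<lambda>m n. pure_tensor K M N (r \<odot>\<^bsub>M\<^esub> m) n)"
    unfolding balanced_map_def
  proof (intro conjI ballI)
    fix q m n assume q: "q \<in> carrier K" and mn: "m \<in> carrier M" "n \<in> carrier N"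
    \<comment> \<open>Commutativity of \<open>K\<close> lets \<open>q\<close> come to the front,
      from where it passes to the second factor.\<close>
    have "r \<odot>\<^bsub>M\<^esub> (q \<odot>\<^bsub>M\<^esub> m) = q \<odot>\<^bsub>M\<^esub> (r \<odot>\<^bsub>M\<^esub> m)"
      using r q mn by (simp add: M.R.m_comm flip: M.smult_assoc1)
    with r q mn show "pure_tensor K M N (r \<odot>\<^bsub>M\<^esub> (q \<odot>\<^bsub>M\<^esub> m)) n = pure_tensor K M N (r \<odot>\<^bsub>M\<^esub> m) (q \<odot>\<^bsub>N\<^esub> n)"
      by (simp add: pure_tensor_smult[OF M N])
  qed (use r in \<open>simp_all add: pure_tensor_closed[OF M N] M.smult_r_distr pure_tensor_add_left[OF M N]
          pure_tensor_add_right[OF M N]\<close>)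
  have cls: "r \<odot>\<^bsub>?T\<^esub> tensor_class K M N x = ?h x" if "x \<in> carrier (tensor_free M N)" for x
    using the_elem_image_tensor_class[OF abelian_group_tensor[OF M N] h f _ that]
    by (simp add: tensor_def pure_tensor_eq[OF M N])
  show "PROP ?pure"
    by (simp add: pure_tensor_eq[OF M N] cls)
  show "PROP ?closed"
    using e by (auto simp: carrier_tensor[OF M N] cls)
  show "PROP ?add"
    using e unfolding carrier_tensor[OF M N]
    by (elim imageE) (simp add: cls tensor_class_add[OF M N] add_in_tensor_free frag_extend_add)
qed

text \<open>The axioms with two scalars or the unit scalar have both sides additive in
  \<open>t\<close>, so they reduce to pure tensors, where they come from \<open>M\<close>.\<close>

lemma module_tensor: "module K (tensor K M N)"
proof (rule moduleI)
  show "cring K" ..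
  show "abelian_group (tensor K M N)" ..
  show "(r \<oplus>\<^bsub>K\<^esub> s) \<odot>\<^bsub>tensor K M N\<^esub> t = r \<odot>\<^bsub>tensor K M N\<^esub> t \<oplus>\<^bsub>tensor K M N\<^esub> s \<odot>\<^bsub>tensor K M N\<^esub> t"
    if "r \<in> carrier K" "s \<in> carrier K" "t \<in> carrier (tensor K M N)" for r s t
    using that(3,1,2) pure_tensor_add_left[OF M N]
    by (induction t rule: tensor_induct[OF M N, consumes 1, case_names pure add])
       (simp_all add: smult_tensor_pure smult_tensor_add smult_tensor_closed M.smult_l_distr T.a_ac)
  show "(r \<otimes>\<^bsub>K\<^esub> s) \<odot>\<^bsub>tensor K M N\<^esub> t = r \<odot>\<^bsub>tensor K M N\<^esub> (s \<odot>\<^bsub>tensor K M N\<^esub> t)"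
    if "r \<in> carrier K" "s \<in> carrier K" "t \<in> carrier (tensor K M N)" for r s t
    using that(3,1,2)
    by (induction t rule: tensor_induct[OF M N, consumes 1, case_names pure add])
       (simp_all add: smult_tensor_pure smult_tensor_add smult_tensor_closed M.smult_assoc1)
  show "\<one>\<^bsub>K\<^esub> \<odot>\<^bsub>tensor K M N\<^esub> t = t" if "t \<in> carrier (tensor K M N)" for t
    using that
    by (induction t rule: tensor_induct[OF M N, consumes 1, case_names pure add])
       (simp_all add: smult_tensor_pure smult_tensor_add smult_tensor_closed)
qed (simp_all add: smult_tensor_closed smult_tensor_add)

text \<open>Existence half of the universal property for balanced maps: the extension
  \<open>?h\<close> of \<open>f\<close> to the free group kills the relations, so
  \<open>tensor_lift\<close> is evaluated on representatives and inherits additivity.\<close>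

lemma
  assumes P: "abelian_group P" and f: "balanced_map K M N P f"
  shows hom_tensor_lift: "tensor_lift P f \<in> hom (add_monoid (tensor K M N)) (add_monoid P)"
    and tensor_lift_balanced_pure: "\<lbrakk>m \<in> carrier M; n \<in> carrier N\<rbrakk> \<Longrightarrow> tensor_lift P f (pure_tensor K M N m n) = f m n"
proof -
  interpret P: abelian_group P by (rule P)
  let ?h = "\<lambda>x. \<Oplus>\<^bsub>P\<^esub>p\<in>Poly_Mapping.keys x. [Poly_Mapping.lookup x p] \<cdot>\<^bsub>P\<^esub> f (fst p) (snd p)"
  have closed: "f m n \<in> carrier P" if "m \<in> carrier M" "n \<in> carrier N" for m n
    using f that by (auto simp: balanced_map_def)
  \<comment> \<open>Products and integer powers in \<open>add_monoid P\<close> are the sums and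
    integer multiples occurring in \<open>tensor_lift\<close>.\<close>
  have h: "?h \<in> hom (tensor_free M N) (add_monoid P)"
    using P.add.free_Abelian_group_lift_hom[of "\<lambda>p. f (fst p) (snd p)" "carrier M \<times> carrier N"] closed
    unfolding tensor_free_def by (simp add: Pi_iff finsum_def add_pow_def)
  have hf: "?h (frag_of (m, n)) = f m n" if "m \<in> carrier M" "n \<in> carrier N" for m n
    using closed[OF that] by simp
  have cls: "tensor_lift P f (tensor_class K M N x) = ?h x" if "x \<in> carrier (tensor_free M N)" for x
    unfolding tensor_lift_def
    by (rule the_elem_image_tensor_class[OF P h f hf that])
  show "tensor_lift P f \<in> hom (add_monoid (tensor K M N)) (add_monoid P)"
  proof (rule homI)
    fix s assume "s \<in> carrier (add_monoid (tensor K M N))"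
    then obtain x where x: "x \<in> carrier (tensor_free M N)" "s = tensor_class K M N x"
      by (auto simp: carrier_tensor[OF M N])
    then show "tensor_lift P f s \<in> carrier (add_monoid P)"
      using hom_in_carrier[OF h] by (simp add: cls)
    fix t assume "t \<in> carrier (add_monoid (tensor K M N))"
    then obtain y where y: "y \<in> carrier (tensor_free M N)" "t = tensor_class K M N y"
      by (auto simp: carrier_tensor[OF M N])
    show "tensor_lift P f (s \<otimes>\<^bsub>add_monoid (tensor K M N)\<^esub> t) =
        tensor_lift P f s \<otimes>\<^bsub>add_monoid P\<^esub> tensor_lift P f t"
      using hom_mult[OF h x(1) y(1)] x y
      by (simp add: cls tensor_class_add[OF M N] add_in_tensor_free)
  qed
  show "\<lbrakk>m \<in> carrier M; n \<in> carrier N\<rbrakk> \<Longrightarrow> tensor_lift P f (pure_tensor K M N m n) = f m n"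
    by (simp only: pure_tensor_eq[OF M N] cls hf frag_of_in_tensor_free)
qed

end

section \<open>Linear and bilinear maps\<close>

lemma linear_mapI:
  assumes "\<And>x. x \<in> carrier M \<Longrightarrow> f x \<in> carrier N"
    and "\<And>x y. \<lbrakk>x \<in> carrier M; y \<in> carrier M\<rbrakk> \<Longrightarrow> f (x \<oplus>\<^bsub>M\<^esub> y) = f x \<oplus>\<^bsub>N\<^esub> f y"
    and "\<And>r x. \<lbrakk>r \<in> carrier K; x \<in> carrier M\<rbrakk> \<Longrightarrow> f (r \<odot>\<^bsub>M\<^esub> x) = r \<odot>\<^bsub>N\<^esub> f x"
  shows "linear_map K M N f"
  using assms by (simp add: linear_map_def)

lemma
  assumes "linear_map K M N f"
  shows linear_map_closed: "x \<in> carrier M \<Longrightarrow> f x \<in> carrier N"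
    and linear_map_add: "\<lbrakk>x \<in> carrier M; y \<in> carrier M\<rbrakk> \<Longrightarrow> f (x \<oplus>\<^bsub>M\<^esub> y) = f x \<oplus>\<^bsub>N\<^esub> f y"
    and linear_map_smult: "\<lbrakk>r \<in> carrier K; x \<in> carrier M\<rbrakk> \<Longrightarrow> f (r \<odot>\<^bsub>M\<^esub> x) = r \<odot>\<^bsub>N\<^esub> f x"
  using assms by (auto simp: linear_map_def)

lemma linear_map_cong:
  assumes "module K M" and "\<And>x. x \<in> carrier M \<Longrightarrow> f x = g x"
  shows "linear_map K M N f \<longleftrightarrow> linear_map K M N g"
proof -
  interpret M: module K M by fact
  show ?thesis using assms(2) by (auto simp: linear_map_def Pi_iff)
qed

lemma linear_map_id: "linear_map K M M id"
  by (simp add: linear_map_def)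

lemma linear_map_comp:
  "\<lbrakk>linear_map K M N f; linear_map K N P g\<rbrakk> \<Longrightarrow> linear_map K M P (g \<circ> f)"
  by (auto simp: linear_map_def Pi_iff)

text \<open>Serves the sum case of \<open>linear_map_tensor_lift_param\<close>; homogeneity and
  regrouping use the module axioms of \<open>P\<close>.\<close>

lemma linear_map_pointwise_add:
  assumes "module K P" "linear_map K M P f" "linear_map K M P g"
  shows "linear_map K M P (\<lambda>x. f x \<oplus>\<^bsub>P\<^esub> g x)"
proof -
  interpret P: module K P by fact
  show ?thesis
    using assms(2,3) by (auto simp: linear_map_def Pi_iff P.smult_r_distr P.a_ac)
qed

text \<open>Bilinearity is phrased through \<open>linear_map\<close> in each variable, so that
  fixing an argument or composing reduces to facts on linear maps.\<close>

definition bilinear_map ::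
    "'k ring \<Rightarrow> ('k, 'm) module \<Rightarrow> ('k, 'n) module \<Rightarrow> ('k, 'p) module \<Rightarrow> ('m \<Rightarrow> 'n \<Rightarrow> 'p) \<Rightarrow> bool" where
  "bilinear_map K M N P f \<longleftrightarrow>
     (\<forall>m\<in>carrier M. linear_map K N P (f m)) \<and> (\<forall>n\<in>carrier N. linear_map K M P (\<lambda>m. f m n))"

lemma bilinear_mapI:
  assumes "\<And>m. m \<in> carrier M \<Longrightarrow> linear_map K N P (f m)"
    and "\<And>n. n \<in> carrier N \<Longrightarrow> linear_map K M P (\<lambda>m. f m n)"
  shows "bilinear_map K M N P f"
  using assms by (simp add: bilinear_map_def)

lemma
  assumes "bilinear_map K M N P f"
  shows bilinear_map_linear_right: "m \<in> carrier M \<Longrightarrow> linear_map K N P (f m)"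
    and bilinear_map_linear_left: "n \<in> carrier N \<Longrightarrow> linear_map K M P (\<lambda>m. f m n)"
    and bilinear_map_closed: "\<lbrakk>m \<in> carrier M; n \<in> carrier N\<rbrakk> \<Longrightarrow> f m n \<in> carrier P"
  using assms by (auto simp: bilinear_map_def linear_map_def)

lemma bilinear_map_comp:
  assumes f: "bilinear_map K M N P f" and "linear_map K M' M g" "linear_map K N' N h"
  shows "bilinear_map K M' N' P (\<lambda>m n. f (g m) (h n))"
  using assms by (auto simp: bilinear_map_def linear_map_def Pi_iff)

lemma linear_map_comp_bilinear:
  assumes "linear_map K P Q h" and "bilinear_map K M N P f"
  shows "bilinear_map K M N Q (\<lambda>m n. h (f m n))"
  using assms by (auto simp: bilinear_map_def linear_map_def Pi_iff)

text \<open>Both \<open>f (r m) n\<close> and \<open>f m (r n)\<close> equal \<open>r\<close> times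
  \<open>f m n\<close>.\<close>

lemma bilinear_map_imp_balanced_map: "bilinear_map K M N P f \<Longrightarrow> balanced_map K M N P f"
  by (auto simp: bilinear_map_def linear_map_def balanced_map_def Pi_iff)

lemma bilinear_pure_tensor:
  assumes M: "module K M" and N: "module K N"
  shows "bilinear_map K M N (tensor K M N) (pure_tensor K M N)"
proof -
  interpret N: module K N by (rule N)
  show ?thesis
    by (intro bilinear_mapI linear_mapI)
      (simp_all add: pure_tensor_closed[OF M N] pure_tensor_add_left[OF M N] pure_tensor_add_right[OF M N]
        smult_tensor_pure[OF M N] pure_tensor_smult[OF M N])
qed

text \<open>Uniqueness half of the universal property. Most identities below are proved by showing
  that both sides are linear in one tensor and comparing them on pure ones.\<close>

lemma tensor_linear_eqI:
  assumes M: "module K M" and N: "module K N"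
    and f: "linear_map K (tensor K M N) P f" and g: "linear_map K (tensor K M N) P g"
    and eq: "\<And>m n. \<lbrakk>m \<in> carrier M; n \<in> carrier N\<rbrakk> \<Longrightarrow> f (pure_tensor K M N m n) = g (pure_tensor K M N m n)"
    and t: "t \<in> carrier (tensor K M N)"
  shows "f t = g t"
  using t by (induction t rule: tensor_induct[OF M N, consumes 1, case_names pure add]) (simp_all add: eq linear_map_add[OF f] linear_map_add[OF g])

lemma tensor_lift_pure:
  assumes M: "module K M" and N: "module K N" and P: "module K P" and f: "bilinear_map K M N P f"
    and "m \<in> carrier M" "n \<in> carrier N"
  shows "tensor_lift P f (pure_tensor K M N m n) = f m n"
proof -
  interpret P: module K P by (rule P)
  show ?thesis
    by (rule tensor_lift_balanced_pure
        [OF M N P.abelian_group_axioms bilinear_map_imp_balanced_map[OF f]]) fact+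
qed

text \<open>Additivity is the universal property for abelian groups; homogeneity follows by
  induction on the tensor, the pure case being linearity of \<open>f\<close> in its first
  argument.\<close>

lemma linear_map_tensor_lift:
  assumes M: "module K M" and N: "module K N" and P: "module K P" and f: "bilinear_map K M N P f"
  shows "linear_map K (tensor K M N) P (tensor_lift P f)"
proof -
  interpret M: module K M by (rule M)
  interpret P: module K P by (rule P)
  interpret T: module K "tensor K M N" by (rule module_tensor[OF M N])
  note hom = hom_tensor_lift[OF M N P.abelian_group_axioms bilinear_map_imp_balanced_map[OF f]]
  have closed: "tensor_lift P f t \<in> carrier P" if "t \<in> carrier (tensor K M N)" for t
    using hom_in_carrier[OF hom] that by simp
  have lift_add: "tensor_lift P f (s \<oplus>\<^bsub>tensor K M N\<^esub> t) = tensor_lift P f s \<oplus>\<^bsub>P\<^esub> tensor_lift P f t"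
    if "s \<in> carrier (tensor K M N)" "t \<in> carrier (tensor K M N)" for s t
    using hom_mult[OF hom] that by simp
  show ?thesis
  proof (rule linear_mapI)
    fix r t assume r: "r \<in> carrier K" and "t \<in> carrier (tensor K M N)"
    from this(2) show "tensor_lift P f (r \<odot>\<^bsub>tensor K M N\<^esub> t) = r \<odot>\<^bsub>P\<^esub> tensor_lift P f t"
    proof (induction t rule: tensor_induct[OF M N, consumes 1, case_names pure add])
      case (pure m n)
      then show ?case
        using r linear_map_smult[OF bilinear_map_linear_left[OF f]]
        by (simp add: smult_tensor_pure[OF M N] tensor_lift_pure[OF M N P f])
    next
      case (add s t)
      then show ?case
        using r by (simp add: T.smult_r_distr lift_add closed P.smult_r_distr)
    qed
  qed (rule closed lift_add; assumption)+
qed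

text \<open>For pure \<open>t\<close> the lift is \<open>f z m n\<close>, linear in \<open>z\<close>
  by hypothesis, and sums of linear maps are linear. Such a parameter arises in nested tensor
  products and in actions, where it is the vector acted upon.\<close>

lemma linear_map_tensor_lift_param:
  assumes M: "module K M" and N: "module K N" and P: "module K P" and Z: "module K Z"
    and f: "\<And>z. z \<in> carrier Z \<Longrightarrow> bilinear_map K M N P (f z)"
    and fz: "\<And>m n. \<lbrakk>m \<in> carrier M; n \<in> carrier N\<rbrakk> \<Longrightarrow> linear_map K Z P (\<lambda>z. f z m n)"
    and t: "t \<in> carrier (tensor K M N)"
  shows "linear_map K Z P (\<lambda>z. tensor_lift P (f z) t)"
  using t
proof (induction t rule: tensor_induct[OF M N, consumes 1, case_names pure add])
  case (pure m n)
  then show ?case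
    using fz by (subst linear_map_cong[OF Z, where g = "\<lambda>z. f z m n"]) (simp_all add: tensor_lift_pure[OF M N P f])
next
  case (add s t)
  then show ?case
    using linear_map_pointwise_add[OF P add.IH]
    by (subst linear_map_cong[OF Z, where g = "\<lambda>z. tensor_lift P (f z) s \<oplus>\<^bsub>P\<^esub> tensor_lift P (f z) t"])
       (simp_all add: linear_map_add[OF linear_map_tensor_lift[OF M N P f]])
qed

lemma bilinear_map_tensor_lift:
  assumes M: "module K M" and N: "module K N" and P: "module K P" and Z: "module K Z"
    and f: "\<And>z. z \<in> carrier Z \<Longrightarrow> bilinear_map K M N P (f z)"
    and fz: "\<And>m n. \<lbrakk>m \<in> carrier M; n \<in> carrier N\<rbrakk> \<Longrightarrow> linear_map K Z P (\<lambda>z. f z m n)"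
  shows "bilinear_map K (tensor K M N) Z P (\<lambda>t z. tensor_lift P (f z) t)"
proof (rule bilinear_mapI)
  show "linear_map K Z P (\<lambda>z. tensor_lift P (f z) t)" if "t \<in> carrier (tensor K M N)" for t
    by (rule linear_map_tensor_lift_param[OF M N P Z f fz that])
  show "linear_map K (tensor K M N) P (\<lambda>t. tensor_lift P (f z) t)" if "z \<in> carrier Z" for z
    by (rule linear_map_tensor_lift[OF M N P f[OF that]])
qed

text \<open>The first part gives meaning to the right-hand side of \<open>twist_compatible\<close>;
  linearity in \<open>m\<close>, handled as a parameter of the lift, turns the lifted formula into a
  bilinear action of \<open>A \<otimes> B\<close>.\<close>

lemma
  assumes A: "module K A" and B: "module K B" and M: "module K M"
    and actA: "bilinear_map K A M M actA" and actB: "bilinear_map K B M M actB"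
  shows bilinear_map_nested_action: "m \<in> carrier M \<Longrightarrow> bilinear_map K A B M (\<lambda>a b. actA a (actB b m))"
    and bilinear_map_tensor_action:
      "bilinear_map K (tensor K A B) M M (\<lambda>t m. tensor_lift M (\<lambda>a b. actA a (actB b m)) t)"
proof -
  have b: "bilinear_map K A B M (\<lambda>a b. actA a (actB b m))" if "m \<in> carrier M" for m
    using bilinear_map_comp[OF actA linear_map_id bilinear_map_linear_left[OF actB that]] by simp
  then show "m \<in> carrier M \<Longrightarrow> bilinear_map K A B M (\<lambda>a b. actA a (actB b m))" .
  have lin: "linear_map K M M (\<lambda>m. actA a (actB b m))" if "a \<in> carrier A" "b \<in> carrier B" for a b
    using linear_map_comp[OF bilinear_map_linear_right[OF actB that(2)] bilinear_map_linear_right[OF actA that(1)]]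
    by (simp add: comp_def)
  show "bilinear_map K (tensor K A B) M M (\<lambda>t m. tensor_lift M (\<lambda>a b. actA a (actB b m)) t)"
    by (rule bilinear_map_tensor_lift[where f = "\<lambda>m a b. actA a (actB b m)", OF A B M M b lin])
qed

section \<open>Tensor products of maps and the associators\<close>

lemma bilinear_map_flip: "bilinear_map K M N P f \<Longrightarrow> bilinear_map K N M P (\<lambda>n m. f m n)"
  by (auto simp: bilinear_map_def)

lemma
  assumes X: "module K X" and Y: "module K Y" and M: "module K M" and N: "module K N"
    and f: "linear_map K X M f" and g: "linear_map K Y N g"
  shows linear_map_tensor_map: "linear_map K (tensor K X Y) (tensor K M N) (tensor_map K M N f g)"
    and tensor_map_pure: "\<lbrakk>x \<in> carrier X; y \<in> carrier Y\<rbrakk> \<Longrightarrow>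
      tensor_map K M N f g (pure_tensor K X Y x y) = pure_tensor K M N (f x) (g y)"
proof -
  note b = bilinear_map_comp[OF bilinear_pure_tensor[OF M N] f g]
  show "linear_map K (tensor K X Y) (tensor K M N) (tensor_map K M N f g)"
    unfolding tensor_map_def by (rule linear_map_tensor_lift[OF X Y module_tensor[OF M N] b])
  show "\<lbrakk>x \<in> carrier X; y \<in> carrier Y\<rbrakk> \<Longrightarrow>
      tensor_map K M N f g (pure_tensor K X Y x y) = pure_tensor K M N (f x) (g y)"
    unfolding tensor_map_def by (rule tensor_lift_pure[OF X Y module_tensor[OF M N] b])
qed

text \<open>For fixed \<open>z\<close> the inner lift runs over \<open>x\<close> and
  \<open>y\<close> and depends linearly on \<open>z\<close>; hence it is bilinear in the inner
  tensor and \<open>z\<close>, and can be lifted again.\<close>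

lemma
  assumes X: "module K X" and Y: "module K Y" and Z: "module K Z"
  shows linear_map_tensor_assoc:
      "linear_map K (tensor K (tensor K X Y) Z) (tensor K X (tensor K Y Z)) (tensor_assoc K X Y Z)"
    and tensor_assoc_pure: "\<lbrakk>x \<in> carrier X; y \<in> carrier Y; z \<in> carrier Z\<rbrakk> \<Longrightarrow>
      tensor_assoc K X Y Z (pure_tensor K (tensor K X Y) Z (pure_tensor K X Y x y) z) =
      pure_tensor K X (tensor K Y Z) x (pure_tensor K Y Z y z)"
proof -
  note YZ = module_tensor[OF Y Z] and XY = module_tensor[OF X Y]
  note pYZ = bilinear_pure_tensor[OF Y Z] and pX = bilinear_pure_tensor[OF X YZ]
  note T = module_tensor[OF X YZ]
  have f: "bilinear_map K X Y (tensor K X (tensor K Y Z))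
      (\<lambda>x y. pure_tensor K X (tensor K Y Z) x (pure_tensor K Y Z y z))" if "z \<in> carrier Z" for z
    using bilinear_map_comp[OF pX linear_map_id bilinear_map_linear_left[OF pYZ that]] by simp
  have fz: "linear_map K Z (tensor K X (tensor K Y Z))
      (\<lambda>z. pure_tensor K X (tensor K Y Z) x (pure_tensor K Y Z y z))"
    if "x \<in> carrier X" "y \<in> carrier Y" for x y
    using linear_map_comp[OF bilinear_map_linear_right[OF pYZ] bilinear_map_linear_right[OF pX]] that
    by (simp add: comp_def)
  note b = bilinear_map_tensor_lift[OF X Y T Z f fz]
  show "linear_map K (tensor K (tensor K X Y) Z) (tensor K X (tensor K Y Z)) (tensor_assoc K X Y Z)"
    unfolding tensor_assoc_def by (rule linear_map_tensor_lift[OF XY Z T b])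
  show "\<lbrakk>x \<in> carrier X; y \<in> carrier Y; z \<in> carrier Z\<rbrakk> \<Longrightarrow>
      tensor_assoc K X Y Z (pure_tensor K (tensor K X Y) Z (pure_tensor K X Y x y) z) =
      pure_tensor K X (tensor K Y Z) x (pure_tensor K Y Z y z)"
    unfolding tensor_assoc_def
    by (simp add: tensor_lift_pure[OF XY Z T b] tensor_lift_pure[OF X Y T f] pure_tensor_closed[OF X Y])
qed

text \<open>Mirror image of the preceding argument. The parameter \<open>x\<close> now stands to the
  left of the inner tensor, whence the use of \<open>bilinear_map_flip\<close>.\<close>

lemma
  assumes X: "module K X" and Y: "module K Y" and Z: "module K Z"
  shows linear_map_tensor_assoc_inv:
      "linear_map K (tensor K X (tensor K Y Z)) (tensor K (tensor K X Y) Z) (tensor_assoc_inv K X Y Z)"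
    and tensor_assoc_inv_pure: "\<lbrakk>x \<in> carrier X; y \<in> carrier Y; z \<in> carrier Z\<rbrakk> \<Longrightarrow>
      tensor_assoc_inv K X Y Z (pure_tensor K X (tensor K Y Z) x (pure_tensor K Y Z y z)) =
      pure_tensor K (tensor K X Y) Z (pure_tensor K X Y x y) z"
proof -
  note YZ = module_tensor[OF Y Z] and XY = module_tensor[OF X Y]
  note pXY = bilinear_pure_tensor[OF X Y] and pZ = bilinear_pure_tensor[OF XY Z]
  note T = module_tensor[OF XY Z]
  have f: "bilinear_map K Y Z (tensor K (tensor K X Y) Z)
      (\<lambda>y z. pure_tensor K (tensor K X Y) Z (pure_tensor K X Y x y) z)" if "x \<in> carrier X" for x
    using bilinear_map_comp[OF pZ bilinear_map_linear_right[OF pXY that] linear_map_id] by simp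
  have fx: "linear_map K X (tensor K (tensor K X Y) Z)
      (\<lambda>x. pure_tensor K (tensor K X Y) Z (pure_tensor K X Y x y) z)"
    if "y \<in> carrier Y" "z \<in> carrier Z" for y z
    using linear_map_comp[OF bilinear_map_linear_left[OF pXY] bilinear_map_linear_left[OF pZ]] that
    by (simp add: comp_def)
  note b = bilinear_map_flip[OF bilinear_map_tensor_lift[OF Y Z T X f fx]]
  show "linear_map K (tensor K X (tensor K Y Z)) (tensor K (tensor K X Y) Z) (tensor_assoc_inv K X Y Z)"
    unfolding tensor_assoc_inv_def by (rule linear_map_tensor_lift[OF X YZ T b])
  show "\<lbrakk>x \<in> carrier X; y \<in> carrier Y; z \<in> carrier Z\<rbrakk> \<Longrightarrow>
      tensor_assoc_inv K X Y Z (pure_tensor K X (tensor K Y Z) x (pure_tensor K Y Z y z)) =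
      pure_tensor K (tensor K X Y) Z (pure_tensor K X Y x y) z"
    unfolding tensor_assoc_inv_def
    by (simp add: tensor_lift_pure[OF X YZ T b] tensor_lift_pure[OF Y Z T f] pure_tensor_closed[OF Y Z])
qed

section \<open>Modules over a twisted product\<close>

text \<open>Compare in \<open>s\<close> with \<open>t\<close> fixed, which makes \<open>s\<close>
  pure, and then in \<open>t\<close>.\<close>

lemma tensor_bilinear_eqI:
  assumes M: "module K M" and N: "module K N" and M': "module K M'" and N': "module K N'"
    and f: "bilinear_map K (tensor K M N) (tensor K M' N') P f"
    and g: "bilinear_map K (tensor K M N) (tensor K M' N') P g"
    and eq: "\<And>m n m' n'. \<lbrakk>m \<in> carrier M; n \<in> carrier N; m' \<in> carrier M'; n' \<in> carrier N'\<rbrakk> \<Longrightarrow>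
      f (pure_tensor K M N m n) (pure_tensor K M' N' m' n') = g (pure_tensor K M N m n) (pure_tensor K M' N' m' n')"
    and s: "s \<in> carrier (tensor K M N)" and t: "t \<in> carrier (tensor K M' N')"
  shows "f s t = g s t"
proof (rule tensor_linear_eqI[OF M N bilinear_map_linear_left[OF f t] bilinear_map_linear_left[OF g t] _ s])
  fix m n assume mn: "m \<in> carrier M" "n \<in> carrier N"
  note p = pure_tensor_closed[OF M N mn]
  show "f (pure_tensor K M N m n) t = g (pure_tensor K M N m n) t"
    by (rule tensor_linear_eqI[OF M' N' bilinear_map_linear_right[OF f p] bilinear_map_linear_right[OF g p] _ t])
       (rule eq[OF mn])
qed

text \<open>The construction reads only carrier, addition and scalars. Giving a factor a new
  multiplication and unit, as \<open>twisted_product\<close> does, therefore leaves its tensor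
  products unchanged.\<close>

lemma tensor_cong:
  assumes "carrier M = carrier M'" "add M = add M'" "smult M = smult M'"
    and "carrier N = carrier N'" "add N = add N'" "smult N = smult N'"
  shows "tensor K M N = tensor K M' N'" and "pure_tensor K M N = pure_tensor K M' N'"
  using assms by (simp_all add: tensor_def tensor_rel_def tensor_free_def pure_tensor_def fun_eq_iff)

text \<open>Separates the linear part of an action, to be treated by the universal property, from
  the multiplicative and unit laws.\<close>

lemma left_module_iff:
  "left_module K A M act \<longleftrightarrow> module K M \<and> bilinear_map K A M M act \<and>
    (\<forall>a\<in>carrier A. \<forall>a'\<in>carrier A. \<forall>m\<in>carrier M. act (a \<otimes>\<^bsub>A\<^esub> a') m = act a (act a' m)) \<and>
    (\<forall>m\<in>carrier M. act \<one>\<^bsub>A\<^esub> m = m)"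
  by (auto simp: left_module_def left_module_axioms_def bilinear_map_def linear_map_def Pi_iff)

lemma left_module_bilinear: "left_module K A M act \<Longrightarrow> bilinear_map K A M M act"
  by (simp add: left_module_iff)

text \<open>
  The axiom \<open>(x y) \<cdot> m = x \<cdot> (y \<cdot> m)\<close> makes sense over a nonassociative algebra. Hence
  \<open>A \<otimes> B \<otimes> C\<close> can be treated as a twisted product of the factors \<open>A \<otimes> B\<close> and \<open>C\<close> by a map that
  is only known to be linear and unital.
\<close>

definition unital_nonassoc_algebra :: "'k ring \<Rightarrow> ('k, 'a) module \<Rightarrow> bool" where
  "unital_nonassoc_algebra K A \<longleftrightarrow> module K A \<and> bilinear_map K A A A (monoid.mult A) \<and>
     \<one>\<^bsub>A\<^esub> \<in> carrier A \<and> (\<forall>a\<in>carrier A. \<one>\<^bsub>A\<^esub> \<otimes>\<^bsub>A\<^esub> a = a \<and> a \<otimes>\<^bsub>A\<^esub> \<one>\<^bsub>A\<^esub> = a)"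

lemma unital_algebra_imp_nonassoc:
  assumes "unital_algebra K A"
  shows "unital_nonassoc_algebra K A"
proof -
  interpret unital_algebra K A by fact
  show ?thesis
    unfolding unital_nonassoc_algebra_def bilinear_map_def linear_map_def
    by (auto simp: l_distr r_distr smult_mult_left smult_mult_right module_axioms)
qed

text \<open>Actions are total functions with arbitrary values off the carriers, so actions given by
  equations on the carriers must be transported. Closure of \<open>A\<close> under product and unit
  allows \<open>eq\<close> to be applied inside the module axioms.\<close>

lemma left_module_cong:
  assumes A: "unital_nonassoc_algebra K A"
    and act: "left_module K A M act"
    and eq: "\<And>a m. \<lbrakk>a \<in> carrier A; m \<in> carrier M\<rbrakk> \<Longrightarrow> act' a m = act a m"
  shows "left_module K A M act'"
proof -
  interpret A: module K A using A by (simp add: unital_nonassoc_algebra_def)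
  interpret act: left_module K A M act by (rule act)
  have "a \<otimes>\<^bsub>A\<^esub> b \<in> carrier A" if "a \<in> carrier A" "b \<in> carrier A" for a b
    using A that bilinear_map_closed[of K A A A "monoid.mult A"] by (simp add: unital_nonassoc_algebra_def)
  moreover have "\<one>\<^bsub>A\<^esub> \<in> carrier A"
    using A by (simp add: unital_nonassoc_algebra_def)
  ultimately show ?thesis
    by unfold_locales
      (simp_all add: eq act.act_closed act.act_add_left act.act_add_right act.act_smult_left
        act.act_smult_right act.act_mult act.act_one)
qed

text \<open>The common form of \<open>R1\<close>, \<open>R2\<close>, \<open>R3\<close> and
  \<open>iterated_twist\<close> under which the same lemmas are applied at both stages.\<close>

definition unital_linear_twist ::
    "'k ring \<Rightarrow> ('k, 'a) module \<Rightarrow> ('k, 'b) module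
      \<Rightarrow> (('b \<times> 'a \<Rightarrow>\<^sub>0 int) set \<Rightarrow> ('a \<times> 'b \<Rightarrow>\<^sub>0 int) set) \<Rightarrow> bool" where
  "unital_linear_twist K A B R \<longleftrightarrow>
     linear_map K (tensor K B A) (tensor K A B) R \<and>
     (\<forall>a\<in>carrier A. R (pure_tensor K B A \<one>\<^bsub>B\<^esub> a) = pure_tensor K A B a \<one>\<^bsub>B\<^esub>) \<and>
     (\<forall>b\<in>carrier B. R (pure_tensor K B A b \<one>\<^bsub>A\<^esub>) = pure_tensor K A B \<one>\<^bsub>A\<^esub> b)"

lemma unital_twisting_map_imp_linear_twist:
  "unital_twisting_map K A B R \<Longrightarrow> unital_linear_twist K A B R"
  by (simp add: unital_twisting_map_def twisting_map_def unital_linear_twist_def)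

section \<open>Linear structure of a twisted product\<close>

lemma twisted_product_simps [simp]:
  "carrier (twisted_product K A B R) = carrier (tensor K A B)"
  "add (twisted_product K A B R) = add (tensor K A B)"
  "ring.zero (twisted_product K A B R) = ring.zero (tensor K A B)"
  "smult (twisted_product K A B R) = smult (tensor K A B)"
  "one (twisted_product K A B R) = pure_tensor K A B \<one>\<^bsub>A\<^esub> \<one>\<^bsub>B\<^esub>"
  "monoid.mult (twisted_product K A B R) =
     (\<lambda>x y. twisted_mult_map K A B R (pure_tensor K (tensor K A B) (tensor K A B) x y))"
  by (simp_all add: twisted_product_def)

lemma tensor_twisted_product [simp]:
  "tensor K (twisted_product K A B R) C = tensor K (tensor K A B) C"
  "tensor K C (twisted_product K A B R) = tensor K C (tensor K A B)"
  "pure_tensor K (twisted_product K A B R) C = pure_tensor K (tensor K A B) C"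
  "pure_tensor K C (twisted_product K A B R) = pure_tensor K C (tensor K A B)"
  by (rule tensor_cong; simp)+

lemma linear_map_twisted_product [simp]:
  "linear_map K (twisted_product K A B R) N f \<longleftrightarrow> linear_map K (tensor K A B) N f"
  "linear_map K N (twisted_product K A B R) g \<longleftrightarrow> linear_map K N (tensor K A B) g"
  by (simp_all add: linear_map_def)

lemma bilinear_map_twisted_product [simp]:
  "bilinear_map K (twisted_product K A B R) N P f \<longleftrightarrow> bilinear_map K (tensor K A B) N P f"
  "bilinear_map K N (twisted_product K A B R) P f' \<longleftrightarrow> bilinear_map K N (tensor K A B) P f'"
  "bilinear_map K M N (twisted_product K A B R) g \<longleftrightarrow> bilinear_map K M N (tensor K A B) g"
  by (simp_all add: bilinear_map_def)

lemma module_twisted_product: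
  assumes A: "module K A" and B: "module K B"
  shows "module K (twisted_product K A B R)"
proof -
  interpret T: module K "tensor K A B" by (rule module_tensor[OF A B])
  have "abelian_group (twisted_product K A B R)"
    by (intro abelian_groupI) (auto simp: T.a_ac intro: T.l_neg)
  then show ?thesis
    by (intro moduleI) (simp_all add: T.smult_l_distr T.smult_r_distr T.smult_assoc1 T.R.is_cring)
qed

section \<open>Multiplication in a twisted product\<close>

context
  fixes K :: "'k ring" and A :: "('k, 'a) module" and B :: "('k, 'b) module"
    and R :: "('b \<times> 'a \<Rightarrow>\<^sub>0 int) set \<Rightarrow> ('a \<times> 'b \<Rightarrow>\<^sub>0 int) set"
  assumes A: "unital_nonassoc_algebra K A" and B: "unital_nonassoc_algebra K B"
    and R: "linear_map K (tensor K B A) (tensor K A B) R"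
begin

private lemma module_factors: "module K A" "module K B"
  and bilinear_factors: "bilinear_map K A A A (monoid.mult A)" "bilinear_map K B B B (monoid.mult B)"
  and one_closed: "\<one>\<^bsub>A\<^esub> \<in> carrier A" "\<one>\<^bsub>B\<^esub> \<in> carrier B"
  and one_left: "a \<in> carrier A \<Longrightarrow> \<one>\<^bsub>A\<^esub> \<otimes>\<^bsub>A\<^esub> a = a" "b \<in> carrier B \<Longrightarrow> \<one>\<^bsub>B\<^esub> \<otimes>\<^bsub>B\<^esub> b = b"
  and one_right: "a \<in> carrier A \<Longrightarrow> a \<otimes>\<^bsub>A\<^esub> \<one>\<^bsub>A\<^esub> = a" "b \<in> carrier B \<Longrightarrow> b \<otimes>\<^bsub>B\<^esub> \<one>\<^bsub>B\<^esub> = b"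
  using A B by (simp_all add: unital_nonassoc_algebra_def)

private lemmas modules = module_factors module_tensor[OF module_factors]
  module_tensor[OF module_factors(2,1)] module_tensor[OF module_factors(1,1)] module_tensor[OF module_factors(2,2)]
private lemmas pure_closed = pure_tensor_closed[OF module_factors]
private lemmas bilinear_pure = bilinear_pure_tensor[OF module_factors]

lemma linear_map_twisted_mult_map:
  "linear_map K (tensor K (tensor K A B) (tensor K A B)) (tensor K A B) (twisted_mult_map K A B R)"
  unfolding twisted_mult_map_def mult_map_def
  by (rule linear_map_comp linear_map_tensor_assoc linear_map_tensor_assoc_inv linear_map_tensor_map
      linear_map_tensor_lift linear_map_id module_tensor module_factors bilinear_factors R)+

lemma bilinear_map_twisted_mult:
  "bilinear_map K (tensor K A B) (tensor K A B) (tensor K A B)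
    (\<lambda>x y. twisted_mult_map K A B R (pure_tensor K (tensor K A B) (tensor K A B) x y))"
  by (rule linear_map_comp_bilinear[OF linear_map_twisted_mult_map bilinear_pure_tensor[OF modules(3,3)]])

text \<open>Reassociating a product of pure tensors isolates \<open>b \<otimes> a'\<close>, to which
  \<open>R\<close> is applied. The maps applied afterwards are linear in the value of
  \<open>R\<close>, and on \<open>u \<otimes> v\<close> they give
  \<open>a u \<otimes> v b'\<close>.\<close>

lemma twisted_mult_pure:
  assumes a: "a \<in> carrier A" "a' \<in> carrier A" and b: "b \<in> carrier B" "b' \<in> carrier B"
  shows "pure_tensor K A B a b \<otimes>\<^bsub>twisted_product K A B R\<^esub> pure_tensor K A B a' b' =
    tensor_map K A B (\<lambda>u. a \<otimes>\<^bsub>A\<^esub> u) (\<lambda>v. v \<otimes>\<^bsub>B\<^esub> b') (R (pure_tensor K B A b a'))"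
proof -
  let ?BB = "tensor K B B" and ?AB = "tensor K A B"
  let ?E = "tensor_map K A B (mult_map A) (mult_map B) \<circ> tensor_assoc_inv K A A ?BB"
  \<comment> \<open>\<open>?F\<close> is the part of \<open>twisted_mult_map\<close> that follows
    \<open>R\<close>, as a function of \<open>t = R (b \<otimes> a')\<close>, which need not be
    pure.\<close>
  let ?F = "?E \<circ> pure_tensor K A (tensor K A ?BB) a \<circ> tensor_assoc K A B B \<circ> (\<lambda>t. pure_tensor K ?AB B t b')"
  let ?G = "tensor_map K A B (\<lambda>u. a \<otimes>\<^bsub>A\<^esub> u) (\<lambda>v. v \<otimes>\<^bsub>B\<^esub> b')"
  note m = module_factors modules
  note mult = linear_map_tensor_lift[OF m(1,1,1) bilinear_factors(1), folded mult_map_def]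
    linear_map_tensor_lift[OF m(2,2,2) bilinear_factors(2), folded mult_map_def]
  note mult_pure = tensor_lift_pure[OF m(1,1,1) bilinear_factors(1), folded mult_map_def]
    tensor_lift_pure[OF m(2,2,2) bilinear_factors(2), folded mult_map_def]
  note G = bilinear_map_linear_right[OF bilinear_factors(1) a(1)] bilinear_map_linear_left[OF bilinear_factors(2) b(2)]
  have Rc: "R (pure_tensor K B A b a') \<in> carrier ?AB"
    by (rule linear_map_closed[OF R pure_tensor_closed]) (use a b m in auto)
  have F: "linear_map K ?AB ?AB ?F"
    by (rule linear_map_comp linear_map_tensor_assoc linear_map_tensor_assoc_inv linear_map_tensor_map
        module_tensor module_factors mult a b bilinear_map_linear_left[OF bilinear_pure_tensor]
        bilinear_map_linear_right[OF bilinear_pure_tensor])+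
  have "pure_tensor K A B a b \<otimes>\<^bsub>twisted_product K A B R\<^esub> pure_tensor K A B a' b' = ?F (R (pure_tensor K B A b a'))"
    unfolding twisted_product_simps twisted_mult_map_def comp_apply
    using a b Rc m
    by (simp add: tensor_assoc_pure tensor_assoc_inv_pure module_tensor pure_tensor_closed
        tensor_map_pure[OF _ _ _ _ linear_map_id linear_map_tensor_assoc_inv]
        tensor_map_pure[OF _ _ _ _ linear_map_id linear_map_tensor_assoc]
        tensor_map_pure[OF _ _ _ _ linear_map_id linear_map_tensor_map[OF _ _ _ _ R linear_map_id]]
        tensor_map_pure[OF _ _ _ _ R linear_map_id])
  also have "\<dots> = ?G (R (pure_tensor K B A b a'))"
  proof (rule tensor_linear_eqI[OF m(1,2) F linear_map_tensor_map[OF m(1,2) m(1,2) G] _ Rc])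
    fix u v assume uv: "u \<in> carrier A" "v \<in> carrier B"
    show "?F (pure_tensor K A B u v) = ?G (pure_tensor K A B u v)"
      using uv a b m
      by (simp add: tensor_assoc_pure tensor_assoc_inv_pure module_tensor pure_tensor_closed
          tensor_map_pure[OF _ _ _ _ mult] tensor_map_pure[OF _ _ _ _ G] mult_pure)
  qed
  finally show ?thesis .
qed

text \<open>Unitality of \<open>R\<close> turns \<open>(1 \<otimes> 1) (a \<otimes> b)\<close> into
  \<open>1 a \<otimes> 1 b\<close>, and similarly on the right; linearity does the rest. The twisted
  product can thus be a factor of a further twisted product.\<close>

lemma unital_nonassoc_algebra_twisted_product:
  assumes "unital_linear_twist K A B R"
  shows "unital_nonassoc_algebra K (twisted_product K A B R)"
proof -
  let ?AB = "tensor K A B" and ?P = "twisted_product K A B R"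
  note m = module_factors modules and one = one_closed
  have one_twist: "R (pure_tensor K B A \<one>\<^bsub>B\<^esub> a) = pure_tensor K A B a \<one>\<^bsub>B\<^esub>"
    "R (pure_tensor K B A b \<one>\<^bsub>A\<^esub>) = pure_tensor K A B \<one>\<^bsub>A\<^esub> b" if "a \<in> carrier A" "b \<in> carrier B" for a b
    using assms that by (simp_all add: unital_linear_twist_def)
  have mult_lin: "linear_map K A A (\<lambda>u. a \<otimes>\<^bsub>A\<^esub> u)" "linear_map K B B (\<lambda>v. v \<otimes>\<^bsub>B\<^esub> b)"
    if "a \<in> carrier A" "b \<in> carrier B" for a b
    using that bilinear_map_linear_right[OF bilinear_factors(1)] bilinear_map_linear_left[OF bilinear_factors(2)] by auto
  have bil: "bilinear_map K ?AB ?AB ?AB (monoid.mult ?P)"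
    unfolding twisted_product_simps by (rule bilinear_map_twisted_mult)
  have e: "\<one>\<^bsub>?P\<^esub> \<in> carrier ?AB"
    by (simp add: pure_closed one)
  have l: "\<one>\<^bsub>?P\<^esub> \<otimes>\<^bsub>?P\<^esub> t = id t" and r: "t \<otimes>\<^bsub>?P\<^esub> \<one>\<^bsub>?P\<^esub> = id t" if t: "t \<in> carrier ?AB" for t
  proof -
    show "\<one>\<^bsub>?P\<^esub> \<otimes>\<^bsub>?P\<^esub> t = id t"
      by (rule tensor_linear_eqI[OF m(1,2) bilinear_map_linear_right[OF bil e] linear_map_id _ t])
        (simp add: twisted_mult_pure[simplified] one one_twist tensor_map_pure[OF m(1,2,1,2) mult_lin] one_left one_right)
    show "t \<otimes>\<^bsub>?P\<^esub> \<one>\<^bsub>?P\<^esub> = id t"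
      by (rule tensor_linear_eqI[OF m(1,2) bilinear_map_linear_left[OF bil e] linear_map_id _ t])
        (simp add: twisted_mult_pure[simplified] one one_twist tensor_map_pure[OF m(1,2,1,2) mult_lin] one_left one_right)
  qed
  show ?thesis
    unfolding unital_nonassoc_algebra_def
    using bil e l r module_twisted_product[OF m(1,2)] by simp
qed

section \<open>Actions of a twisted product\<close>

context
  fixes M :: "('k, 'm) module"
  assumes M: "module K M"
begin

text \<open>The multiplicative law is bilinear in the two algebra elements, so it is checked on pure
  tensors, where \<open>twisted_mult_pure\<close>, \<open>slide\<close> and the compatibility
  condition apply in turn.\<close>

lemma left_module_twisted_product:
  assumes actA: "left_module K A M actA" and actB: "left_module K B M actB"
    and compat: "twist_compatible K A B R M actA actB"
  shows "left_module K (twisted_product K A B R) M (\<lambda>t m. tensor_lift M (\<lambda>a b. actA a (actB b m)) t)"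
    (is "left_module K ?P M ?act")
proof -
  let ?AB = "tensor K A B"
  note m = module_factors modules
  interpret actA: left_module K A M actA by (rule actA)
  interpret actB: left_module K B M actB by (rule actB)
  note bA = left_module_bilinear[OF actA] and bB = left_module_bilinear[OF actB]
  note b = bilinear_map_nested_action[OF module_factors M bA bB] and bact = bilinear_map_tensor_action[OF module_factors M bA bB]
  note pure = tensor_lift_pure[OF m(1,2) M b]
  note mult_lin = bilinear_map_linear_right[OF bilinear_factors(1)] bilinear_map_linear_left[OF bilinear_factors(2)]
  \<comment> \<open>For pure \<open>t = u \<otimes> v\<close> this is \<open>(a u) \<cdot> ((v b')
    \<cdot> x) = a \<cdot> (u \<cdot> (v \<cdot> (b' \<cdot> x)))\<close>; both sides are linear in
    \<open>t\<close>, so it also holds at the values of \<open>R\<close>.\<close>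
  have slide: "?act (tensor_map K A B (\<lambda>u. a \<otimes>\<^bsub>A\<^esub> u) (\<lambda>v. v \<otimes>\<^bsub>B\<^esub> b') t) x = actA a (?act t (actB b' x))"
    if a: "a \<in> carrier A" and b': "b' \<in> carrier B" and x: "x \<in> carrier M" and t: "t \<in> carrier ?AB" for a b' x t
  proof -
    let ?G = "tensor_map K A B (\<lambda>u. a \<otimes>\<^bsub>A\<^esub> u) (\<lambda>v. v \<otimes>\<^bsub>B\<^esub> b')"
    have "((\<lambda>t. ?act t x) \<circ> ?G) t = (actA a \<circ> (\<lambda>t. ?act t (actB b' x))) t"
    proof (rule tensor_linear_eqI[OF m(1,2) _ _ _ t])
      show "linear_map K ?AB M ((\<lambda>t. ?act t x) \<circ> ?G)"
        by (rule linear_map_comp[OF linear_map_tensor_map[OF m(1,2,1,2) mult_lin(1)[OF a] mult_lin(2)[OF b']] bilinear_map_linear_left[OF bact x]])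
      show "linear_map K ?AB M (actA a \<circ> (\<lambda>t. ?act t (actB b' x)))"
        by (rule linear_map_comp[OF bilinear_map_linear_left[OF bact] bilinear_map_linear_right[OF bA a]])
           (rule actB.act_closed[OF b' x])
      fix u v assume uv: "u \<in> carrier A" "v \<in> carrier B"
      then show "((\<lambda>t. ?act t x) \<circ> ?G) (pure_tensor K A B u v) =
          (actA a \<circ> (\<lambda>t. ?act t (actB b' x))) (pure_tensor K A B u v)"
        using a b' x
        by (simp add: tensor_map_pure[OF m(1,2,1,2) mult_lin] pure actA.act_mult actB.act_mult
            actB.act_closed bilinear_map_closed[OF bilinear_factors(1)] bilinear_map_closed[OF bilinear_factors(2)])
    qed
    then show ?thesis by simp
  qed
  have act_mult: "?act (s \<otimes>\<^bsub>?P\<^esub> t) x = ?act s (?act t x)"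
    if s: "s \<in> carrier ?AB" and t: "t \<in> carrier ?AB" and x: "x \<in> carrier M" for s t x
  proof (rule tensor_bilinear_eqI[OF m(1,2,1,2) _ _ _ s t])
    show "bilinear_map K ?AB ?AB M (\<lambda>s t. ?act (s \<otimes>\<^bsub>?P\<^esub> t) x)"
      unfolding twisted_product_simps
      by (rule linear_map_comp_bilinear[OF bilinear_map_linear_left[OF bact x] bilinear_map_twisted_mult])
    show "bilinear_map K ?AB ?AB M (\<lambda>s t. ?act s (?act t x))"
      using bilinear_map_comp[OF bact linear_map_id bilinear_map_linear_left[OF bact x]] by simp
    fix a b a' b' assume *: "a \<in> carrier A" "b \<in> carrier B" "a' \<in> carrier A" "b' \<in> carrier B"
    have "R (pure_tensor K B A b a') \<in> carrier ?AB"
      by (rule linear_map_closed[OF R pure_tensor_closed[OF m(2,1)]]) (use * in auto)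
    with * x have "?act (pure_tensor K A B a b \<otimes>\<^bsub>?P\<^esub> pure_tensor K A B a' b') x =
        actA a (?act (R (pure_tensor K B A b a')) (actB b' x))"
      by (simp only: twisted_mult_pure slide)
    \<comment> \<open>Compatibility is used for \<open>b\<close>, \<open>a'\<close> and the vector
      \<open>b' \<cdot> x\<close>, read from right to left.\<close>
    also have "\<dots> = actA a (actB b (actA a' (actB b' x)))"
      using compat * x by (simp add: twist_compatible_def actB.act_closed)
    also have "\<dots> = ?act (pure_tensor K A B a b) (?act (pure_tensor K A B a' b') x)"
      using * x by (simp add: pure actA.act_closed actB.act_closed)
    finally show "?act (pure_tensor K A B a b \<otimes>\<^bsub>?P\<^esub> pure_tensor K A B a' b') x =
        ?act (pure_tensor K A B a b) (?act (pure_tensor K A B a' b') x)" .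
  qed
  show ?thesis
    unfolding left_module_iff
    using M bact act_mult one_closed
    by (simp add: pure actA.act_one actB.act_one)
qed

section \<open>Unital twists and restriction to the factors\<close>

context
  assumes R_unital: "unital_linear_twist K A B R"
begin

private lemma R_one:
  "a \<in> carrier A \<Longrightarrow> R (pure_tensor K B A \<one>\<^bsub>B\<^esub> a) = pure_tensor K A B a \<one>\<^bsub>B\<^esub>"
  "b \<in> carrier B \<Longrightarrow> R (pure_tensor K B A b \<one>\<^bsub>A\<^esub>) = pure_tensor K A B \<one>\<^bsub>A\<^esub> b"
  using R_unital by (simp_all add: unital_linear_twist_def)

text \<open>In \<open>twisted_mult_pure\<close> the outer multiplications are now by units, hence
  the identity of \<open>A \<otimes> B\<close>. The twist is thereby recovered from the
  product.\<close>

lemma twisted_mult_swap: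
  assumes a: "a \<in> carrier A" and b: "b \<in> carrier B"
  shows "pure_tensor K A B \<one>\<^bsub>A\<^esub> b \<otimes>\<^bsub>twisted_product K A B R\<^esub> pure_tensor K A B a \<one>\<^bsub>B\<^esub> =
    R (pure_tensor K B A b a)"
proof -
  note m = module_factors modules
  note mult_lin = bilinear_map_linear_right[OF bilinear_factors(1)] bilinear_map_linear_left[OF bilinear_factors(2)]
  have "tensor_map K A B (\<lambda>u. \<one>\<^bsub>A\<^esub> \<otimes>\<^bsub>A\<^esub> u) (\<lambda>v. v \<otimes>\<^bsub>B\<^esub> \<one>\<^bsub>B\<^esub>) t = id t" if "t \<in> carrier (tensor K A B)" for t
    by (rule tensor_linear_eqI[OF m(1,2) linear_map_tensor_map[OF m(1,2,1,2) mult_lin(1)[OF one_closed(1)] mult_lin(2)[OF one_closed(2)]] linear_map_id _ that])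
       (simp add: tensor_map_pure[OF m(1,2,1,2) mult_lin] one_closed one_left one_right)
  moreover have "R (pure_tensor K B A b a) \<in> carrier (tensor K A B)"
    by (rule linear_map_closed[OF R pure_tensor_closed[OF m(2,1)]]) (use a b in auto)
  ultimately show ?thesis
    using a b by (simp only: twisted_mult_pure one_closed id_apply)
qed

text \<open>Acting by \<open>a\<close> and then by \<open>b\<close> is acting by
  \<open>(1 \<otimes> b) (a \<otimes> 1) = R (b \<otimes> a)\<close>, and by linearity
  \<open>eq\<close> determines the action of this tensor as a lift.\<close>

lemma twist_compatibleI:
  assumes act: "left_module K (twisted_product K A B R) M act"
    and actA: "left_module K A M actA" and actB: "left_module K B M actB"
    and eq: "\<And>a b m. \<lbrakk>a \<in> carrier A; b \<in> carrier B; m \<in> carrier M\<rbrakk> \<Longrightarrow>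
      act (pure_tensor K A B a b) m = actA a (actB b m)"
  shows "twist_compatible K A B R M actA actB"
  unfolding twist_compatible_def
proof (intro ballI)
  let ?P = "twisted_product K A B R"
  interpret actA: left_module K A M actA by (rule actA)
  interpret actB: left_module K B M actB by (rule actB)
  interpret act: left_module K ?P M act by (rule act)
  note m = module_factors modules
  note b = bilinear_map_nested_action[OF module_factors M left_module_bilinear[OF actA] left_module_bilinear[OF actB]]
  have bact: "bilinear_map K (tensor K A B) M M act"
    using left_module_bilinear[OF act] by simp
  fix a b x assume *: "a \<in> carrier A" "b \<in> carrier B" and x: "x \<in> carrier M"
  have "actB b (actA a x) = act (pure_tensor K A B \<one>\<^bsub>A\<^esub> b) (act (pure_tensor K A B a \<one>\<^bsub>B\<^esub>) x)"
    using * x one_closed by (simp add: eq actA.act_one actB.act_one actA.act_closed actB.act_closed)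
  also have "\<dots> = act (R (pure_tensor K B A b a)) x"
    using * x one_closed act.act_mult[of "pure_tensor K A B \<one>\<^bsub>A\<^esub> b" "pure_tensor K A B a \<one>\<^bsub>B\<^esub>" x]
    by (simp add: pure_closed twisted_mult_swap del: twisted_product_simps(6))
  also have "\<dots> = tensor_lift M (\<lambda>a' b'. actA a' (actB b' x)) (R (pure_tensor K B A b a))"
  proof (rule tensor_linear_eqI[OF m(1,2) bilinear_map_linear_left[OF bact x] linear_map_tensor_lift[OF m(1,2) M b[OF x]]])
    show "R (pure_tensor K B A b a) \<in> carrier (tensor K A B)"
      by (rule linear_map_closed[OF R pure_tensor_closed[OF m(2,1)]]) (use * in auto)
  qed (simp add: eq x tensor_lift_pure[OF m(1,2) M b])
  finally show "actB b (actA a x) = tensor_lift M (\<lambda>a' b'. actA a' (actB b' x)) (R (pure_tensor K B A b a))" .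
qed

text \<open>Both \<open>a \<mapsto> a \<otimes> 1\<close> and
  \<open>b \<mapsto> 1 \<otimes> b\<close> are linear, multiplicative and unital, so the action
  pulls back along them; the last claim is
  \<open>(a \<otimes> 1) (1 \<otimes> b) = a \<otimes> b\<close>.\<close>

lemma
  assumes act: "left_module K (twisted_product K A B R) M act"
  shows left_module_restrict_left: "left_module K A M (\<lambda>a. act (pure_tensor K A B a \<one>\<^bsub>B\<^esub>))"
    and left_module_restrict_right: "left_module K B M (\<lambda>b. act (pure_tensor K A B \<one>\<^bsub>A\<^esub> b))"
    and action_pure_tensor: "\<lbrakk>a \<in> carrier A; b \<in> carrier B; m \<in> carrier M\<rbrakk> \<Longrightarrow>
      act (pure_tensor K A B a b) m = act (pure_tensor K A B a \<one>\<^bsub>B\<^esub>) (act (pure_tensor K A B \<one>\<^bsub>A\<^esub> b) m)"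
proof -
  let ?P = "twisted_product K A B R"
  interpret act: left_module K ?P M act by (rule act)
  note m = module_factors modules
  note mult_lin = bilinear_map_linear_right[OF bilinear_factors(1)] bilinear_map_linear_left[OF bilinear_factors(2)]
  note simps = R_one one_closed one_left one_right tensor_map_pure[OF m(1,2,1,2) mult_lin]
  have bact: "bilinear_map K (tensor K A B) M M act"
    using left_module_bilinear[OF act] by simp
  have act_mult: "act (s \<otimes>\<^bsub>?P\<^esub> t) x = act s (act t x)"
    if "s \<in> carrier (tensor K A B)" "t \<in> carrier (tensor K A B)" "x \<in> carrier M" for s t x
    using act.act_mult that unfolding twisted_product_simps(1) by blast
  have one: "act (pure_tensor K A B \<one>\<^bsub>A\<^esub> \<one>\<^bsub>B\<^esub>) x = x" if "x \<in> carrier M" for x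
    using act.act_one[OF that] by simp
  \<comment> \<open>In this product and the next two, \<open>R\<close> is evaluated with a unit in
    at least one argument, so \<open>R_one\<close> computes it.\<close>
  have AA: "pure_tensor K A B a \<one>\<^bsub>B\<^esub> \<otimes>\<^bsub>?P\<^esub> pure_tensor K A B a' \<one>\<^bsub>B\<^esub> = pure_tensor K A B (a \<otimes>\<^bsub>A\<^esub> a') \<one>\<^bsub>B\<^esub>"
    if "a \<in> carrier A" "a' \<in> carrier A" for a a'
    using that by (simp add: twisted_mult_pure simps del: twisted_product_simps(6))
  have BB: "pure_tensor K A B \<one>\<^bsub>A\<^esub> b \<otimes>\<^bsub>?P\<^esub> pure_tensor K A B \<one>\<^bsub>A\<^esub> b' = pure_tensor K A B \<one>\<^bsub>A\<^esub> (b \<otimes>\<^bsub>B\<^esub> b')"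
    if "b \<in> carrier B" "b' \<in> carrier B" for b b'
    using that by (simp add: twisted_mult_pure simps del: twisted_product_simps(6))
  have AB: "pure_tensor K A B a \<one>\<^bsub>B\<^esub> \<otimes>\<^bsub>?P\<^esub> pure_tensor K A B \<one>\<^bsub>A\<^esub> b = pure_tensor K A B a b"
    if "a \<in> carrier A" "b \<in> carrier B" for a b
    using that by (simp add: twisted_mult_pure simps del: twisted_product_simps(6))
  show "left_module K A M (\<lambda>a. act (pure_tensor K A B a \<one>\<^bsub>B\<^esub>))"
    unfolding left_module_iff
    using bilinear_map_comp[OF bact bilinear_map_linear_left[OF bilinear_pure one_closed(2)] linear_map_id]
    by (simp add: M one pure_closed one_closed flip: act_mult AA)
  show "left_module K B M (\<lambda>b. act (pure_tensor K A B \<one>\<^bsub>A\<^esub> b))"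
    unfolding left_module_iff
    using bilinear_map_comp[OF bact bilinear_map_linear_right[OF bilinear_pure one_closed(1)] linear_map_id]
    by (simp add: M one pure_closed one_closed flip: act_mult BB)
  show "\<lbrakk>a \<in> carrier A; b \<in> carrier B; m \<in> carrier M\<rbrakk> \<Longrightarrow>
      act (pure_tensor K A B a b) m = act (pure_tensor K A B a \<one>\<^bsub>B\<^esub>) (act (pure_tensor K A B \<one>\<^bsub>A\<^esub> b) m)"
    by (simp add: pure_closed one_closed AB del: twisted_product_simps(6) flip: act_mult)
qed

text \<open>This is the reading of a compatibility condition as a module structure over a product of
  two factors. The witness is the lift of \<open>a \<cdot> (b \<cdot> m)\<close>.\<close>

lemma twist_compatible_iff_left_module:
  assumes actA: "left_module K A M actA" and actB: "left_module K B M actB"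
  shows "twist_compatible K A B R M actA actB \<longleftrightarrow>
    (\<exists>act. left_module K (twisted_product K A B R) M act \<and>
      (\<forall>a\<in>carrier A. \<forall>b\<in>carrier B. \<forall>m\<in>carrier M. act (pure_tensor K A B a b) m = actA a (actB b m)))"
proof
  note b = bilinear_map_nested_action[OF module_factors M left_module_bilinear[OF actA] left_module_bilinear[OF actB]]
  assume "twist_compatible K A B R M actA actB"
  from left_module_twisted_product[OF actA actB this]
  show "\<exists>act. left_module K (twisted_product K A B R) M act \<and>
      (\<forall>a\<in>carrier A. \<forall>b\<in>carrier B. \<forall>m\<in>carrier M. act (pure_tensor K A B a b) m = actA a (actB b m))"
    by (intro exI conjI ballI) (auto simp: tensor_lift_pure[OF module_factors M b])
qed (use twist_compatibleI[OF _ actA actB] in blast)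

end

end

end

section \<open>Modules over an iterated twisted product\<close>

context
  fixes K :: "'k ring"
    and A :: "('k, 'a) module" and B :: "('k, 'b) module" and C :: "('k, 'c) module"
    and R1 :: "('b \<times> 'a \<Rightarrow>\<^sub>0 int) set \<Rightarrow> ('a \<times> 'b \<Rightarrow>\<^sub>0 int) set"
    and R2 :: "('c \<times> 'b \<Rightarrow>\<^sub>0 int) set \<Rightarrow> ('b \<times> 'c \<Rightarrow>\<^sub>0 int) set"
    and R3 :: "('c \<times> 'a \<Rightarrow>\<^sub>0 int) set \<Rightarrow> ('a \<times> 'c \<Rightarrow>\<^sub>0 int) set"
  assumes A: "unital_nonassoc_algebra K A" and B: "unital_nonassoc_algebra K B"
    and C: "unital_nonassoc_algebra K C"
    and R1: "unital_linear_twist K A B R1" and R2: "unital_linear_twist K B C R2"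
    and R3: "unital_linear_twist K A C R3"
begin

private lemma factors:
  "module K A" "module K B" "module K C"
  "\<one>\<^bsub>A\<^esub> \<in> carrier A" "\<one>\<^bsub>B\<^esub> \<in> carrier B" "\<one>\<^bsub>C\<^esub> \<in> carrier C"
  using A B C by (simp_all add: unital_nonassoc_algebra_def)

private lemma twists:
  "linear_map K (tensor K B A) (tensor K A B) R1"
  "linear_map K (tensor K C B) (tensor K B C) R2"
  "linear_map K (tensor K C A) (tensor K A C) R3"
  "b \<in> carrier B \<Longrightarrow> R2 (pure_tensor K C B \<one>\<^bsub>C\<^esub> b) = pure_tensor K B C b \<one>\<^bsub>C\<^esub>"
  "c \<in> carrier C \<Longrightarrow> R2 (pure_tensor K C B c \<one>\<^bsub>B\<^esub>) = pure_tensor K B C \<one>\<^bsub>B\<^esub> c"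
  "a \<in> carrier A \<Longrightarrow> R3 (pure_tensor K C A \<one>\<^bsub>C\<^esub> a) = pure_tensor K A C a \<one>\<^bsub>C\<^esub>"
  "c \<in> carrier C \<Longrightarrow> R3 (pure_tensor K C A c \<one>\<^bsub>A\<^esub>) = pure_tensor K A C \<one>\<^bsub>A\<^esub> c"
  using R1 R2 R3 by (simp_all add: unital_linear_twist_def)

private lemmas triple_modules = factors(1-3) module_tensor[OF factors(1,2)] module_tensor[OF factors(2,3)]
  module_tensor[OF factors(1,3)]
private lemmas triple_simps = factors triple_modules module_tensor pure_tensor_closed
  tensor_assoc_pure tensor_assoc_inv_pure twists
  tensor_map_pure[OF _ _ _ _ linear_map_id twists(2)] tensor_map_pure[OF _ _ _ _ twists(3) linear_map_id]

lemma linear_map_iterated_twist: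
  "linear_map K (tensor K C (tensor K A B)) (tensor K (tensor K A B) C) (iterated_twist K A B C R2 R3)"
  unfolding iterated_twist_def
  by (rule linear_map_comp linear_map_tensor_assoc linear_map_tensor_assoc_inv linear_map_tensor_map
      linear_map_id module_tensor triple_modules twists(2,3))+

text \<open>The evaluation stops at \<open>R3 (c \<otimes> a)\<close>, which in general is not pure;
  what follows is linear in it.\<close>

lemma iterated_twist_pure:
  assumes "a \<in> carrier A" "b \<in> carrier B" "c \<in> carrier C"
  shows "iterated_twist K A B C R2 R3 (pure_tensor K C (tensor K A B) c (pure_tensor K A B a b)) =
    tensor_assoc_inv K A B C (tensor_map K A (tensor K B C) id R2 (tensor_assoc K A C B
      (pure_tensor K (tensor K A C) B (R3 (pure_tensor K C A c a)) b)))"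
  unfolding iterated_twist_def using assms by (simp add: triple_simps)

text \<open>A unit of \<open>C\<close> passes \<open>a\<close> by unitality of \<open>R3\<close> and
  then \<open>b\<close> by unitality of \<open>R2\<close>; likewise \<open>c\<close> passes
  \<open>1 \<otimes> 1\<close>. In the first case \<open>t\<close> is arbitrary and is reduced to
  pure tensors, in the second the unit is already pure.\<close>

lemma unital_iterated_twist:
  "unital_linear_twist K (twisted_product K A B R1) C (iterated_twist K A B C R2 R3)"
proof -
  have "iterated_twist K A B C R2 R3 (pure_tensor K C (tensor K A B) \<one>\<^bsub>C\<^esub> t) = pure_tensor K (tensor K A B) C t \<one>\<^bsub>C\<^esub>"
    if t: "t \<in> carrier (tensor K A B)" for t
  proof -
    have "(iterated_twist K A B C R2 R3 \<circ> pure_tensor K C (tensor K A B) \<one>\<^bsub>C\<^esub>) t = pure_tensor K (tensor K A B) C t \<one>\<^bsub>C\<^esub>"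
      by (rule tensor_linear_eqI[OF triple_modules(1,2)
            linear_map_comp[OF bilinear_map_linear_right[OF bilinear_pure_tensor[OF triple_modules(3,4)] factors(6)] linear_map_iterated_twist]
            bilinear_map_linear_left[OF bilinear_pure_tensor[OF triple_modules(4,3)] factors(6)] _ t])
         (simp add: triple_simps iterated_twist_pure)
    then show ?thesis by simp
  qed
  moreover have "iterated_twist K A B C R2 R3 (pure_tensor K C (tensor K A B) c (pure_tensor K A B \<one>\<^bsub>A\<^esub> \<one>\<^bsub>B\<^esub>)) =
      pure_tensor K (tensor K A B) C (pure_tensor K A B \<one>\<^bsub>A\<^esub> \<one>\<^bsub>B\<^esub>) c" if "c \<in> carrier C" for c
    using that by (simp add: triple_simps iterated_twist_pure)
  ultimately show ?thesis
    unfolding unital_linear_twist_def using linear_map_iterated_twist by simp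
qed

section \<open>Compatibility with the iterated twist\<close>

context
  fixes M :: "('k, 'm) module" and actA actB actC actAB
  assumes actA: "left_module K A M actA" and actB: "left_module K B M actB" and actC: "left_module K C M actC"
    and actAB: "left_module K (twisted_product K A B R1) M actAB"
    and actAB_pure: "\<And>a b m. \<lbrakk>a \<in> carrier A; b \<in> carrier B; m \<in> carrier M\<rbrakk> \<Longrightarrow>
      actAB (pure_tensor K A B a b) m = actA a (actB b m)"
begin

interpretation actA: left_module K A M actA by (rule actA)
interpretation actB: left_module K B M actB by (rule actB)
interpretation actC: left_module K C M actC by (rule actC)

private lemma M: "module K M" ..

private lemma bil: "bilinear_map K A M M actA" "bilinear_map K B M M actB" "bilinear_map K C M M actC"
  "bilinear_map K (tensor K A B) M M actAB"
  using actA actB actC actAB by (simp_all add: left_module_iff)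

private lemmas bilBC = bilinear_map_nested_action[OF factors(2,3) M bil(2,3)]
private lemmas bilAC = bilinear_map_nested_action[OF factors(1,3) M bil(1,3)]
private lemmas bilABC = bilinear_map_nested_action[OF triple_modules(4,3) M bil(4,3)]

text \<open>Both sides are linear in \<open>v\<close> and equal
  \<open>a \<cdot> (b \<cdot> (c \<cdot> m))\<close> for \<open>v = b \<otimes> c\<close>. General
  \<open>v\<close> is required because the lemma is applied to values of \<open>R2\<close>.\<close>

private lemma assoc_inv_action:
  assumes a: "a \<in> carrier A" and v: "v \<in> carrier (tensor K B C)" and m: "m \<in> carrier M"
  shows "tensor_lift M (\<lambda>t c. actAB t (actC c m)) (tensor_assoc_inv K A B C (pure_tensor K A (tensor K B C) a v)) =
    actA a (tensor_lift M (\<lambda>b c. actB b (actC c m)) v)"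
proof -
  let ?F = "tensor_lift M (\<lambda>t c. actAB t (actC c m)) \<circ> tensor_assoc_inv K A B C \<circ> pure_tensor K A (tensor K B C) a"
  let ?G = "actA a \<circ> tensor_lift M (\<lambda>b c. actB b (actC c m))"
  have "?F v = ?G v"
  proof (rule tensor_linear_eqI[OF triple_modules(2,3) _ _ _ v])
    show "linear_map K (tensor K B C) M ?F"
      by (rule linear_map_comp linear_map_tensor_assoc_inv linear_map_tensor_lift triple_modules M bilABC[OF m]
          bilinear_map_linear_right[OF bilinear_pure_tensor] a)+
    show "linear_map K (tensor K B C) M ?G"
      by (rule linear_map_comp[OF linear_map_tensor_lift[OF triple_modules(2,3) M bilBC[OF m]] bilinear_map_linear_right[OF bil(1) a]])
    show "?F (pure_tensor K B C b c) = ?G (pure_tensor K B C b c)" if "b \<in> carrier B" "c \<in> carrier C" for b c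
      using that a m
      by (simp add: triple_simps M tensor_lift_pure[OF triple_modules(4,3) M bilABC] tensor_lift_pure[OF triple_modules(2,3) M bilBC]
          actAB_pure actC.act_closed)
  qed
  then show ?thesis by simp
qed

text \<open>For each term \<open>a' \<otimes> c'\<close> of \<open>R3 (c \<otimes> a)\<close>, the
  remaining twist \<open>R2 (c' \<otimes> b)\<close> acts on \<open>m\<close> as
  \<open>c' \<cdot> (b \<cdot> m)\<close> by \<open>compat\<close>. That hypothesis concerns only
  the given \<open>b\<close> and \<open>m\<close>, so the case \<open>b = 1\<close> can be treated
  before full compatibility with \<open>R2\<close> is known.\<close>

private lemma iterated_twist_action:
  assumes a: "a \<in> carrier A" and b: "b \<in> carrier B" and c: "c \<in> carrier C" and m: "m \<in> carrier M"
    and compat: "\<And>c. c \<in> carrier C \<Longrightarrow>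
      actC c (actB b m) = tensor_lift M (\<lambda>b c. actB b (actC c m)) (R2 (pure_tensor K C B c b))"
  shows "tensor_lift M (\<lambda>t c. actAB t (actC c m))
      (iterated_twist K A B C R2 R3 (pure_tensor K C (tensor K A B) c (pure_tensor K A B a b))) =
    tensor_lift M (\<lambda>a c. actA a (actC c (actB b m))) (R3 (pure_tensor K C A c a))"
proof -
  let ?F = "tensor_lift M (\<lambda>t c. actAB t (actC c m)) \<circ> tensor_assoc_inv K A B C
    \<circ> tensor_map K A (tensor K B C) id R2 \<circ> tensor_assoc K A C B \<circ> (\<lambda>u. pure_tensor K (tensor K A C) B u b)"
  let ?G = "tensor_lift M (\<lambda>a c. actA a (actC c (actB b m)))"
  have u: "R3 (pure_tensor K C A c a) \<in> carrier (tensor K A C)"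
    by (rule linear_map_closed[OF twists(3) pure_tensor_closed[OF triple_modules(3,1) c a]])
  have bm: "actB b m \<in> carrier M"
    by (rule actB.act_closed[OF b m])
  have "?F (R3 (pure_tensor K C A c a)) = ?G (R3 (pure_tensor K C A c a))"
  proof (rule tensor_linear_eqI[OF triple_modules(1,3) _ _ _ u])
    show "linear_map K (tensor K A C) M ?F"
      by (rule linear_map_comp linear_map_tensor_assoc_inv linear_map_tensor_assoc linear_map_tensor_map
          linear_map_tensor_lift module_tensor triple_modules M bilABC[OF m] linear_map_id twists(2)
          bilinear_map_linear_left[OF bilinear_pure_tensor] b)+
    show "linear_map K (tensor K A C) M ?G"
      by (rule linear_map_tensor_lift[OF triple_modules(1,3) M bilAC[OF bm]])
    show "?F (pure_tensor K A C a c) = ?G (pure_tensor K A C a c)" if "a \<in> carrier A" "c \<in> carrier C" for a c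
      using that b m linear_map_closed[OF twists(2) pure_tensor_closed[OF triple_modules(3,2) that(2) b]]
      by (simp add: triple_simps M tensor_lift_pure[OF triple_modules(1,3) M bilAC[OF bm]] assoc_inv_action compat)
  qed
  then show ?thesis
    using a b c by (simp add: iterated_twist_pure)
qed

text \<open>\<open>actAB\<close> is any action agreeing with the nested one on pure tensors: it will
  be a restricted action in one direction and a lifted action in the other.\<close>

lemma twist_compatible_iterated_iff:
  "twist_compatible K (twisted_product K A B R1) C (iterated_twist K A B C R2 R3) M actAB actC \<longleftrightarrow>
    twist_compatible K B C R2 M actB actC \<and> twist_compatible K A C R3 M actA actC"
    (is "?AB \<longleftrightarrow> ?B \<and> ?A")
proof (intro iffI conjI)
  assume ?AB
  then have AB: "actC c (actAB t m) =
      tensor_lift M (\<lambda>t c. actAB t (actC c m)) (iterated_twist K A B C R2 R3 (pure_tensor K C (tensor K A B) c t))"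
    if "c \<in> carrier C" "t \<in> carrier (tensor K A B)" "m \<in> carrier M" for c t m
    using that by (simp add: twist_compatible_def)
  show ?B
    unfolding twist_compatible_def
  proof (intro ballI)
    fix b c m assume *: "b \<in> carrier B" "c \<in> carrier C" "m \<in> carrier M"
    then have v: "R2 (pure_tensor K C B c b) \<in> carrier (tensor K B C)"
      by (intro linear_map_closed[OF twists(2)] pure_tensor_closed triple_modules)
    have "actC c (actB b m) = actC c (actAB (pure_tensor K A B \<one>\<^bsub>A\<^esub> b) m)"
      using * by (simp add: actAB_pure factors actA.act_one actB.act_closed)
    \<comment> \<open>With \<open>a = 1\<close>, unitality of \<open>R3\<close> turns
      \<open>c \<otimes> 1\<close> into \<open>1 \<otimes> c\<close>, so only \<open>R2\<close> is
      left in the twist.\<close>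
    also have "\<dots> = tensor_lift M (\<lambda>t c. actAB t (actC c m))
        (tensor_assoc_inv K A B C (pure_tensor K A (tensor K B C) \<one>\<^bsub>A\<^esub> (R2 (pure_tensor K C B c b))))"
      using * by (simp add: AB triple_simps iterated_twist_pure)
    also have "\<dots> = tensor_lift M (\<lambda>b c. actB b (actC c m)) (R2 (pure_tensor K C B c b))"
      using * v linear_map_closed[OF linear_map_tensor_lift[OF triple_modules(2,3) M bilBC] v]
      by (simp add: assoc_inv_action factors actA.act_one)
    finally show "actC c (actB b m) = tensor_lift M (\<lambda>b c. actB b (actC c m)) (R2 (pure_tensor K C B c b))" .
  qed
  show ?A
    unfolding twist_compatible_def
  proof (intro ballI)
    fix a c m assume *: "a \<in> carrier A" "c \<in> carrier C" "m \<in> carrier M"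
    have "actC c (actA a m) = actC c (actAB (pure_tensor K A B a \<one>\<^bsub>B\<^esub>) m)"
      using * by (simp add: actAB_pure factors actB.act_one)
    \<comment> \<open>The case \<open>b = 1\<close>: the hypothesis of
      \<open>iterated_twist_action\<close> holds because
      \<open>R2 (c \<otimes> 1) = 1 \<otimes> c\<close> and the unit of \<open>B\<close> acts
      trivially.\<close>
    also have "\<dots> = tensor_lift M (\<lambda>a c. actA a (actC c (actB \<one>\<^bsub>B\<^esub> m))) (R3 (pure_tensor K C A c a))"
      using * by (subst AB) (simp_all add: triple_simps iterated_twist_action tensor_lift_pure[OF triple_modules(2,3) M bilBC]
          actB.act_one actC.act_closed)
    finally show "actC c (actA a m) = tensor_lift M (\<lambda>a c. actA a (actC c m)) (R3 (pure_tensor K C A c a))"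
      using * by (simp add: actB.act_one)
  qed
next
  assume "?B \<and> ?A"
  then have B': "actC c (actB b m) = tensor_lift M (\<lambda>b c. actB b (actC c m)) (R2 (pure_tensor K C B c b))"
    and A': "actC c (actA a m) = tensor_lift M (\<lambda>a c. actA a (actC c m)) (R3 (pure_tensor K C A c a))"
    if "a \<in> carrier A" "b \<in> carrier B" "c \<in> carrier C" "m \<in> carrier M" for a b c m
    using that by (simp_all add: twist_compatible_def)
  show ?AB
    unfolding twist_compatible_def
  proof (intro ballI)
    fix t c m assume "t \<in> carrier (twisted_product K A B R1)" and c: "c \<in> carrier C" and m: "m \<in> carrier M"
    then have t: "t \<in> carrier (tensor K A B)" by simp
    let ?F = "tensor_lift M (\<lambda>t c. actAB t (actC c m)) \<circ> iterated_twist K A B C R2 R3 \<circ> pure_tensor K C (tensor K A B) c"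
    let ?G = "actC c \<circ> (\<lambda>t. actAB t m)"
    have "?G t = ?F t"
    proof (rule tensor_linear_eqI[OF triple_modules(1,2) _ _ _ t])
      show "linear_map K (tensor K A B) M ?G"
        by (rule linear_map_comp[OF bilinear_map_linear_left[OF bil(4) m] bilinear_map_linear_right[OF bil(3) c]])
      show "linear_map K (tensor K A B) M ?F"
        by (rule linear_map_comp linear_map_iterated_twist linear_map_tensor_lift triple_modules M bilABC[OF m]
            bilinear_map_linear_right[OF bilinear_pure_tensor] c)+
      \<comment> \<open>Compatibility with \<open>R3\<close>, taken at the vector
        \<open>b \<cdot> m\<close>, yields the lift to which \<open>iterated_twist_action\<close>
        reduces \<open>?F\<close>.\<close>
      show "?G (pure_tensor K A B a b) = ?F (pure_tensor K A B a b)" if "a \<in> carrier A" "b \<in> carrier B" for a b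
        using that c m iterated_twist_action[OF that c m B'[OF that(1,2) _ m]]
        by (simp add: actAB_pure A'[OF that c] actB.act_closed)
    qed
    then show "actC c (actAB t m) = tensor_lift M (\<lambda>t c. actAB t (actC c m))
        (iterated_twist K A B C R2 R3 (pure_tensor K C (twisted_product K A B R1) c t))"
      by simp
  qed
qed

end

section \<open>Actions of the iterated product\<close>

private lemmas AB = unital_nonassoc_algebra_twisted_product[OF A B twists(1) R1]

private lemma T:
  "linear_map K (tensor K C (twisted_product K A B R1)) (tensor K (twisted_product K A B R1) C)
    (iterated_twist K A B C R2 R3)"
  using linear_map_iterated_twist by simp

text \<open>The restriction lemmas are applied twice: first to the factors
  \<open>A \<otimes> B\<close> and \<open>C\<close>, then to \<open>A\<close> and \<open>B\<close>.
  The given actions in the last claim need only agree with the restrictions on the carriers.\<close>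

lemma
  fixes M :: "('k, 'm) module"
  assumes M: "module K M" and act: "left_module K (iterated_product K A B C R1 R2 R3) M act"
  shows left_module_iterated_restrict:
      "left_module K A M (\<lambda>a. act (pure_tensor3 K A B C a \<one>\<^bsub>B\<^esub> \<one>\<^bsub>C\<^esub>))" (is "left_module K A M ?a")
      "left_module K B M (\<lambda>b. act (pure_tensor3 K A B C \<one>\<^bsub>A\<^esub> b \<one>\<^bsub>C\<^esub>))" (is "left_module K B M ?b")
      "left_module K C M (\<lambda>c. act (pure_tensor3 K A B C \<one>\<^bsub>A\<^esub> \<one>\<^bsub>B\<^esub> c))" (is "left_module K C M ?c")
    and action_pure_tensor3: "\<lbrakk>a \<in> carrier A; b \<in> carrier B; c \<in> carrier C; m \<in> carrier M\<rbrakk> \<Longrightarrow>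
      act (pure_tensor3 K A B C a b c) m =
      act (pure_tensor3 K A B C a \<one>\<^bsub>B\<^esub> \<one>\<^bsub>C\<^esub>)
        (act (pure_tensor3 K A B C \<one>\<^bsub>A\<^esub> b \<one>\<^bsub>C\<^esub>) (act (pure_tensor3 K A B C \<one>\<^bsub>A\<^esub> \<one>\<^bsub>B\<^esub> c) m))"
    and twist_compatible_iterated_restrict: "\<lbrakk>left_module K A M actA; left_module K B M actB; left_module K C M actC;
      \<And>a m. \<lbrakk>a \<in> carrier A; m \<in> carrier M\<rbrakk> \<Longrightarrow> actA a m = act (pure_tensor3 K A B C a \<one>\<^bsub>B\<^esub> \<one>\<^bsub>C\<^esub>) m;
      \<And>b m. \<lbrakk>b \<in> carrier B; m \<in> carrier M\<rbrakk> \<Longrightarrow> actB b m = act (pure_tensor3 K A B C \<one>\<^bsub>A\<^esub> b \<one>\<^bsub>C\<^esub>) m;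
      \<And>c m. \<lbrakk>c \<in> carrier C; m \<in> carrier M\<rbrakk> \<Longrightarrow> actC c m = act (pure_tensor3 K A B C \<one>\<^bsub>A\<^esub> \<one>\<^bsub>B\<^esub> c) m\<rbrakk> \<Longrightarrow>
      twist_compatible K A B R1 M actA actB \<and> twist_compatible K B C R2 M actB actC \<and>
      twist_compatible K A C R3 M actA actC"
proof -
  let ?t = "\<lambda>t. act (pure_tensor K (tensor K A B) C t \<one>\<^bsub>C\<^esub>)"
  note act' = act[unfolded iterated_product_def]
  note restrict = left_module_restrict_left[OF AB C T M unital_iterated_twist act', simplified]
    left_module_restrict_right[OF AB C T M unital_iterated_twist act', simplified]
  note pure = action_pure_tensor[OF AB C T M unital_iterated_twist act', simplified]
  note pureAB = action_pure_tensor[OF A B twists(1) M R1 restrict(1)]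
  show a: "left_module K A M ?a" and b: "left_module K B M ?b" and c: "left_module K C M ?c"
    unfolding pure_tensor3_def
    using left_module_restrict_left[OF A B twists(1) M R1 restrict(1)]
      left_module_restrict_right[OF A B twists(1) M R1 restrict(1)] restrict(2) by simp_all
  interpret c: left_module K C M ?c by (rule c)
  show "act (pure_tensor3 K A B C a b c) m = ?a a (?b b (?c c m))"
    if "a \<in> carrier A" "b \<in> carrier B" "c \<in> carrier C" "m \<in> carrier M" for a b c m
    using pure[OF pure_tensor_closed[OF factors(1,2) that(1,2)] that(3,4)]
      pureAB[OF that(1,2) c.act_closed[OF that(3,4)]]
    unfolding pure_tensor3_def by (rule trans)
  assume actA: "left_module K A M actA" and actB: "left_module K B M actB" and actC: "left_module K C M actC"
    and eqA: "\<And>a m. \<lbrakk>a \<in> carrier A; m \<in> carrier M\<rbrakk> \<Longrightarrow> actA a m = ?a a m"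
    and eqB: "\<And>b m. \<lbrakk>b \<in> carrier B; m \<in> carrier M\<rbrakk> \<Longrightarrow> actB b m = ?b b m"
    and eqC: "\<And>c m. \<lbrakk>c \<in> carrier C; m \<in> carrier M\<rbrakk> \<Longrightarrow> actC c m = ?c c m"
  interpret actB: left_module K B M actB by (rule actB)
  have eqAB: "?t (pure_tensor K A B a b) m = actA a (actB b m)"
    if "a \<in> carrier A" "b \<in> carrier B" "m \<in> carrier M" for a b m
    using pureAB[OF that] eqA[OF that(1) actB.act_closed[OF that(2,3)]] eqB[OF that(2,3)]
    unfolding pure_tensor3_def by metis
  \<comment> \<open>Seen from the second stage, \<open>act\<close> is nested from the restriction
    \<open>?t\<close> and \<open>actC\<close>, as \<open>twist_compatibleI\<close> requires for the
    factors \<open>A \<otimes> B\<close> and \<open>C\<close>.\<close>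
  have eqABC: "act (pure_tensor K (twisted_product K A B R1) C t c) m = ?t t (actC c m)"
    if "t \<in> carrier (twisted_product K A B R1)" "c \<in> carrier C" "m \<in> carrier M" for t c m
    using pure that eqC[OF that(2,3)] unfolding pure_tensor3_def twisted_product_simps tensor_twisted_product by metis
  have "twist_compatible K A B R1 M actA actB"
    by (rule twist_compatibleI[OF A B twists(1) M R1 restrict(1) actA actB eqAB])
  moreover have "twist_compatible K (twisted_product K A B R1) C (iterated_twist K A B C R2 R3) M ?t actC"
    by (rule twist_compatibleI[OF AB C T M unital_iterated_twist act' restrict(1) actC eqABC])
  ultimately show "twist_compatible K A B R1 M actA actB \<and> twist_compatible K B C R2 M actB actC \<and>
      twist_compatible K A C R3 M actA actC"
    using twist_compatible_iterated_iff[OF actA actB actC restrict(1) eqAB] by simp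
qed

text \<open>Compatibility with \<open>R1\<close> gives an action of \<open>A \<otimes> B\<close>;
  the conditions for \<open>R2\<close> and \<open>R3\<close> together give compatibility of that
  action with the iterated twist, so it extends once more.\<close>

lemma left_module_iterated_product:
  fixes M :: "('k, 'm) module"
  assumes actA: "left_module K A M actA" and actB: "left_module K B M actB" and actC: "left_module K C M actC"
    and compat: "twist_compatible K A B R1 M actA actB" "twist_compatible K B C R2 M actB actC"
      "twist_compatible K A C R3 M actA actC"
  obtains act where "left_module K (iterated_product K A B C R1 R2 R3) M act"
    and "\<And>a b c m. \<lbrakk>a \<in> carrier A; b \<in> carrier B; c \<in> carrier C; m \<in> carrier M\<rbrakk> \<Longrightarrow>
      act (pure_tensor3 K A B C a b c) m = actA a (actB b (actC c m))"
proof -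
  interpret actC: left_module K C M actC by (rule actC)
  have M: "module K M" ..
  let ?t = "\<lambda>t m. tensor_lift M (\<lambda>a b. actA a (actB b m)) t"
  note actAB = left_module_twisted_product[OF A B twists(1) M actA actB compat(1)]
  note bilAB = bilinear_map_nested_action[OF factors(1,2) M left_module_bilinear[OF actA] left_module_bilinear[OF actB]]
  have bt: "bilinear_map K (tensor K A B) M M ?t"
    using left_module_bilinear[OF actAB] by simp
  note bilABC = bilinear_map_nested_action[OF triple_modules(4,3) M bt left_module_bilinear[OF actC]]
  have eqAB: "?t (pure_tensor K A B a b) m = actA a (actB b m)"
    if "a \<in> carrier A" "b \<in> carrier B" "m \<in> carrier M" for a b m
    using that by (simp add: tensor_lift_pure[OF factors(1,2) M bilAB])
  have "twist_compatible K (twisted_product K A B R1) C (iterated_twist K A B C R2 R3) M ?t actC"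
    using twist_compatible_iterated_iff[OF actA actB actC actAB eqAB] compat by blast
  from left_module_twisted_product[OF AB C T M actAB actC this]
  have "left_module K (iterated_product K A B C R1 R2 R3) M (\<lambda>s m. tensor_lift M (\<lambda>t c. ?t t (actC c m)) s)"
    unfolding iterated_product_def .
  then show thesis
    by (rule that)
       (simp add: pure_tensor3_def tensor_lift_pure[OF triple_modules(4,3) M bilABC] eqAB actC.act_closed
         pure_tensor_closed factors)
qed

end

text \<open>Being a module over the triple product is expressed by an action restricting to the
  three given ones. The second conjunct shows that such an action is determined by its restrictions,
  and the last three make precise the meaning of each compatibility condition.\<close>

theorem proposition2p14:
  fixes K :: "'k ring"
    and A :: "('k, 'a) module" and B :: "('k, 'b) module" and C :: "('k, 'c) module"
    and M :: "('k, 'm) module"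
    and R1 :: "('b \<times> 'a \<Rightarrow>\<^sub>0 int) set \<Rightarrow> ('a \<times> 'b \<Rightarrow>\<^sub>0 int) set"
    and R2 :: "('c \<times> 'b \<Rightarrow>\<^sub>0 int) set \<Rightarrow> ('b \<times> 'c \<Rightarrow>\<^sub>0 int) set"
    and R3 :: "('c \<times> 'a \<Rightarrow>\<^sub>0 int) set \<Rightarrow> ('a \<times> 'c \<Rightarrow>\<^sub>0 int) set"
  assumes "cring K"
    and "unital_algebra K A" and "unital_algebra K B" and "unital_algebra K C"
    and "unital_twisting_map K A B R1"
    and "unital_twisting_map K B C R2"
    and "unital_twisting_map K A C R3"
    and "hexagon K A B C R1 R2 R3"
    and "module K M"
  shows "(\<forall>actA actB actC.
      (left_module K A M actA \<and> left_module K B M actB \<and> left_module K C M actC \<and>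
       twist_compatible K A B R1 M actA actB \<and>
       twist_compatible K B C R2 M actB actC \<and>
       twist_compatible K A C R3 M actA actC)
      \<longleftrightarrow>
      (\<exists>act. left_module K (iterated_product K A B C R1 R2 R3) M act \<and>
         (\<forall>a\<in>carrier A. \<forall>m\<in>carrier M.
            actA a m = act (pure_tensor3 K A B C a \<one>\<^bsub>B\<^esub> \<one>\<^bsub>C\<^esub>) m) \<and>
         (\<forall>b\<in>carrier B. \<forall>m\<in>carrier M.
            actB b m = act (pure_tensor3 K A B C \<one>\<^bsub>A\<^esub> b \<one>\<^bsub>C\<^esub>) m) \<and>
         (\<forall>c\<in>carrier C. \<forall>m\<in>carrier M.
            actC c m = act (pure_tensor3 K A B C \<one>\<^bsub>A\<^esub> \<one>\<^bsub>B\<^esub> c) m)))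
    \<and> (\<forall>act. left_module K (iterated_product K A B C R1 R2 R3) M act \<longrightarrow>
      (\<forall>a\<in>carrier A. \<forall>b\<in>carrier B. \<forall>c\<in>carrier C. \<forall>m\<in>carrier M.
         act (pure_tensor3 K A B C a b c) m =
         act (pure_tensor3 K A B C a \<one>\<^bsub>B\<^esub> \<one>\<^bsub>C\<^esub>)
           (act (pure_tensor3 K A B C \<one>\<^bsub>A\<^esub> b \<one>\<^bsub>C\<^esub>)
             (act (pure_tensor3 K A B C \<one>\<^bsub>A\<^esub> \<one>\<^bsub>B\<^esub> c) m))))
    \<and> (\<forall>actA actB. left_module K A M actA \<and> left_module K B M actB \<longrightarrow>
      (twist_compatible K A B R1 M actA actB \<longleftrightarrow>
       (\<exists>act. left_module K (twisted_product K A B R1) M act \<and>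
          (\<forall>a\<in>carrier A. \<forall>b\<in>carrier B. \<forall>m\<in>carrier M.
             act (pure_tensor K A B a b) m = actA a (actB b m)))))
    \<and> (\<forall>actB actC. left_module K B M actB \<and> left_module K C M actC \<longrightarrow>
      (twist_compatible K B C R2 M actB actC \<longleftrightarrow>
       (\<exists>act. left_module K (twisted_product K B C R2) M act \<and>
          (\<forall>b\<in>carrier B. \<forall>c\<in>carrier C. \<forall>m\<in>carrier M.
             act (pure_tensor K B C b c) m = actB b (actC c m)))))
    \<and> (\<forall>actA actC. left_module K A M actA \<and> left_module K C M actC \<longrightarrow>
      (twist_compatible K A C R3 M actA actC \<longleftrightarrow>
       (\<exists>act. left_module K (twisted_product K A C R3) M act \<and>
          (\<forall>a\<in>carrier A. \<forall>c\<in>carrier C. \<forall>m\<in>carrier M.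
             act (pure_tensor K A C a c) m = actA a (actC c m)))))"
proof -
  note A = unital_algebra_imp_nonassoc[OF assms(2)]
    and B = unital_algebra_imp_nonassoc[OF assms(3)]
    and C = unital_algebra_imp_nonassoc[OF assms(4)]
    and R1 = unital_twisting_map_imp_linear_twist[OF assms(5)]
    and R2 = unital_twisting_map_imp_linear_twist[OF assms(6)]
    and R3 = unital_twisting_map_imp_linear_twist[OF assms(7)]
    and M = assms(9)
  have one: "\<one>\<^bsub>A\<^esub> \<in> carrier A" "\<one>\<^bsub>B\<^esub> \<in> carrier B" "\<one>\<^bsub>C\<^esub> \<in> carrier C"
    using A B C by (simp_all add: unital_nonassoc_algebra_def)
  have lin: "linear_map K (tensor K B A) (tensor K A B) R1" "linear_map K (tensor K C B) (tensor K B C) R2"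
    "linear_map K (tensor K C A) (tensor K A C) R3"
    using R1 R2 R3 by (simp_all add: unital_linear_twist_def)
  note restrict = left_module_iterated_restrict[OF A B C R1 R2 R3 M]
  have actions_iff: "(left_module K A M actA \<and> left_module K B M actB \<and> left_module K C M actC \<and>
       twist_compatible K A B R1 M actA actB \<and>
       twist_compatible K B C R2 M actB actC \<and>
       twist_compatible K A C R3 M actA actC)
      \<longleftrightarrow>
      (\<exists>act. left_module K (iterated_product K A B C R1 R2 R3) M act \<and>
         (\<forall>a\<in>carrier A. \<forall>m\<in>carrier M.
            actA a m = act (pure_tensor3 K A B C a \<one>\<^bsub>B\<^esub> \<one>\<^bsub>C\<^esub>) m) \<and>
         (\<forall>b\<in>carrier B. \<forall>m\<in>carrier M.
            actB b m = act (pure_tensor3 K A B C \<one>\<^bsub>A\<^esub> b \<one>\<^bsub>C\<^esub>) m) \<and>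
         (\<forall>c\<in>carrier C. \<forall>m\<in>carrier M.
            actC c m = act (pure_tensor3 K A B C \<one>\<^bsub>A\<^esub> \<one>\<^bsub>B\<^esub> c) m))" (is "?L \<longleftrightarrow> ?R")
    for actA actB actC
  proof
    assume L: ?L
    then obtain act where act: "left_module K (iterated_product K A B C R1 R2 R3) M act"
      and pure: "\<And>a b c m. \<lbrakk>a \<in> carrier A; b \<in> carrier B; c \<in> carrier C; m \<in> carrier M\<rbrakk> \<Longrightarrow>
        act (pure_tensor3 K A B C a b c) m = actA a (actB b (actC c m))"
      using left_module_iterated_product[OF A B C R1 R2 R3] by metis
    interpret actA: left_module K A M actA using L by blast
    interpret actB: left_module K B M actB using L by blast
    interpret actC: left_module K C M actC using L by blast
    \<comment> \<open>Putting units in two of the three slots of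
      \<open>a \<cdot> (b \<cdot> (c \<cdot> m))\<close> returns each given action.\<close>
    show ?R
      using act one by (intro exI[of _ act])
        (simp add: pure actA.act_one actB.act_one actC.act_one actB.act_closed actC.act_closed)
  next
    assume ?R
    then obtain act where act: "left_module K (iterated_product K A B C R1 R2 R3) M act"
      and eqA: "\<And>a m. \<lbrakk>a \<in> carrier A; m \<in> carrier M\<rbrakk> \<Longrightarrow> actA a m = act (pure_tensor3 K A B C a \<one>\<^bsub>B\<^esub> \<one>\<^bsub>C\<^esub>) m"
      and eqB: "\<And>b m. \<lbrakk>b \<in> carrier B; m \<in> carrier M\<rbrakk> \<Longrightarrow> actB b m = act (pure_tensor3 K A B C \<one>\<^bsub>A\<^esub> b \<one>\<^bsub>C\<^esub>) m"
      and eqC: "\<And>c m. \<lbrakk>c \<in> carrier C; m \<in> carrier M\<rbrakk> \<Longrightarrow> actC c m = act (pure_tensor3 K A B C \<one>\<^bsub>A\<^esub> \<one>\<^bsub>B\<^esub> c) m"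
      by auto
    \<comment> \<open>The module axioms hold for the restrictions of \<open>act\<close> and are
      carried over to the given actions, which coincide with them on the carriers.\<close>
    note mods = left_module_cong[OF A restrict(1)[OF act] eqA] left_module_cong[OF B restrict(2)[OF act] eqB]
      left_module_cong[OF C restrict(3)[OF act] eqC]
    have "twist_compatible K A B R1 M actA actB \<and> twist_compatible K B C R2 M actB actC \<and>
        twist_compatible K A C R3 M actA actC"
      by (rule twist_compatible_iterated_restrict[OF A B C R1 R2 R3 M act mods eqA eqB eqC])
    with mods show ?L by (intro conjI) simp_all
  qed
  show ?thesis
    by (intro conjI allI impI ballI; (elim conjE)?)
      (rule actions_iff action_pure_tensor3[OF A B C R1 R2 R3 M]
      twist_compatible_iff_left_module[OF A B lin(1) M R1]
      twist_compatible_iff_left_module[OF B C lin(2) M R2]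
      twist_compatible_iff_left_module[OF A C lin(3) M R3]; assumption)+
qed

end
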